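(* Let $M$ be an $n$-dimensional compact Riemannian manifold without boundary with $\mathrm{Ricci}(M)\ge -K$, where $K\ge 0$ is a constant. Let $u=u(x,t)$ be any positive solution of the heat equation $u_t=\Delta u$ on $M$ (for $t>0$). Let $a:(0,\infty)\to(0,\infty)$ be a $C^1$ positive function satisfying the following assumptions: (A1) for all $t>0$, $a(t)>0$, and $\lim_{t\to 0}a(t)=0$, $\lim_{t\to 0}\frac{a(t)}{a'(t)}=0$; (A2) for any $L>0$, the function $\frac{a'^2}{a}$ is continuous and integrable on the interval $[0,L]$. Then for all $t>0$ (and at every point of $M$), $$|\nabla\log u|^2-\alpha(t)(\log u)_t\le c(t),$$ where $$\alpha(t)=\frac{2K}{a(t)}\int_0^t a(s)\,ds+1,\qquad c(t)=\frac{nK}{2}+\frac{nK^2}{2a(t)}\int_0^t a(s)\,ds+\frac{n}{8a(t)}\int_0^t\frac{a'^2(s)}{a(s)}\,ds.$$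
   Context: $\Delta$ is the Laplace--Beltrami operator and $\nabla$ the gradient on $M$ (acting in the space variable); the subscript $t$ denotes the time derivative. $\mathrm{Ricci}(M)\ge -K$ means $\mathrm{Ricci}(X,X)\ge -K|X|^2$ for all tangent vectors $X$. Here $a'^2(s)$ means $(a'(s))^2$. *)

theory Defs
  imports "HOL-Analysis.Analysis"
begin

text \<open>
  Smoothness on an \<^emph>\<open>open\<close> subset of a Euclidean space: all iterated directional derivatives
  exist (as Frechet derivatives) and are continuous.
\<close>

primrec Ck_on :: "nat \<Rightarrow> 'a::euclidean_space set \<Rightarrow> ('a \<Rightarrow> 'b::real_normed_vector) \<Rightarrow> bool" where
  "Ck_on 0 S f \<longleftrightarrow> continuous_on S f"
| "Ck_on (Suc k) S f \<longleftrightarrow>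
     (\<forall>x\<in>S. f differentiable (at x)) \<and> (\<forall>v. Ck_on k S (\<lambda>x. frechet_derivative f (at x) v))"

definition smooth_on :: "'a::euclidean_space set \<Rightarrow> ('a \<Rightarrow> 'b::real_normed_vector) \<Rightarrow> bool" where
  "smooth_on S f \<longleftrightarrow> (\<forall>k. Ck_on k S f)"

definition pd :: "'n::finite \<Rightarrow> (real^'n \<Rightarrow> real) \<Rightarrow> real^'n \<Rightarrow> real" where
  "pd i h x = frechet_derivative h (at x) (axis i 1)"

text \<open>
  Riemannian geometry in one coordinate domain: \<open>G x $ i $ j\<close> is the component \<open>g\<^sub>i\<^sub>j\<close> of the
  metric at the coordinate point \<open>x\<close>, and tangent vectors are given by their components with
  respect to the coordinate frame.
\<close>

definition metric_ip :: "(real^'n \<Rightarrow> real^'n^'n) \<Rightarrow> real^'n \<Rightarrow> real^'n \<Rightarrow> real^'n::finite \<Rightarrow> real" where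
  "metric_ip G x v w = v \<bullet> (G x *v w)"

text \<open>\<open>christoffel G k i j\<close> is the Christoffel symbol with upper index \<open>k\<close> and lower indices \<open>i\<close>, \<open>j\<close>.\<close>

definition christoffel ::
    "(real^'n \<Rightarrow> real^'n^'n) \<Rightarrow> 'n \<Rightarrow> 'n \<Rightarrow> 'n::finite \<Rightarrow> real^'n \<Rightarrow> real" where
  "christoffel G k i j x =
     (\<Sum>l\<in>UNIV. 1 / 2 * matrix_inv (G x) $ k $ l *
        (pd i (\<lambda>y. G y $ j $ l) x + pd j (\<lambda>y. G y $ i $ l) x - pd l (\<lambda>y. G y $ i $ j) x))"

text \<open>
  \<open>riemann G m j k l\<close> is the component with index \<open>m\<close> of \<open>R(\<partial>\<^sub>k, \<partial>\<^sub>l) \<partial>\<^sub>j\<close>, where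
  \<open>R(X, Y) = \<nabla>\<^sub>X \<nabla>\<^sub>Y - \<nabla>\<^sub>Y \<nabla>\<^sub>X - \<nabla>\<^bsub>[X, Y]\<^esub>\<close>; the Ricci tensor is the trace over \<open>m = k\<close>. With these
  conventions round spheres have positive Ricci curvature.
\<close>

definition riemann ::
    "(real^'n \<Rightarrow> real^'n^'n) \<Rightarrow> 'n \<Rightarrow> 'n \<Rightarrow> 'n \<Rightarrow> 'n::finite \<Rightarrow> real^'n \<Rightarrow> real" where
  "riemann G m j k l x =
     pd k (christoffel G m l j) x - pd l (christoffel G m k j) x
     + (\<Sum>r\<in>UNIV. christoffel G m k r x * christoffel G r l j x
                 - christoffel G m l r x * christoffel G r k j x)"

definition ricci :: "(real^'n \<Rightarrow> real^'n^'n) \<Rightarrow> real^'n \<Rightarrow> real^'n \<Rightarrow> real^'n::finite \<Rightarrow> real" where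
  "ricci G x v w = (\<Sum>j\<in>UNIV. \<Sum>l\<in>UNIV. (\<Sum>k\<in>UNIV. riemann G k j k l x) * v $ j * w $ l)"

definition grad :: "(real^'n \<Rightarrow> real^'n^'n) \<Rightarrow> (real^'n \<Rightarrow> real) \<Rightarrow> real^'n \<Rightarrow> real^'n::finite" where
  "grad G h x = matrix_inv (G x) *v (\<chi> j. pd j h x)"

text \<open>The divergence of a vector field \<open>X\<close> is the trace of its covariant derivative \<open>\<nabla>X\<close>.\<close>

definition divergence ::
    "(real^'n \<Rightarrow> real^'n^'n) \<Rightarrow> (real^'n \<Rightarrow> real^'n) \<Rightarrow> real^'n::finite \<Rightarrow> real" where
  "divergence G X x =
     (\<Sum>i\<in>UNIV. pd i (\<lambda>y. X y $ i) x + (\<Sum>j\<in>UNIV. christoffel G i i j x * X x $ j))"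

definition laplacian :: "(real^'n \<Rightarrow> real^'n^'n) \<Rightarrow> (real^'n \<Rightarrow> real) \<Rightarrow> real^'n::finite \<Rightarrow> real" where
  "laplacian G h = divergence G (grad G h)"


text \<open>
  The manifold is the whole type \<open>'a\<close>; its dimension is \<open>CARD('n)\<close>. A chart is a pair of an open
  domain and a coordinate map (whose values outside the domain are irrelevant).
\<close>

type_synonym ('a, 'n) chart = "'a set \<times> ('a \<Rightarrow> real^'n)"

definition chart_image :: "('a, 'n::finite) chart \<Rightarrow> (real^'n) set" where
  "chart_image c = snd c ` fst c"

definition chart_inv :: "('a, 'n::finite) chart \<Rightarrow> real^'n \<Rightarrow> 'a" where
  "chart_inv c = inv_into (fst c) (snd c)"

definition is_chart :: "('a::topological_space, 'n::finite) chart \<Rightarrow> bool" where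
  "is_chart c \<longleftrightarrow> open (fst c) \<and> open (chart_image c) \<and>
     homeomorphism (fst c) (chart_image c) (snd c) (chart_inv c)"

definition transition :: "('a, 'n::finite) chart \<Rightarrow> ('a, 'n) chart \<Rightarrow> real^'n \<Rightarrow> real^'n" where
  "transition c d = snd d \<circ> chart_inv c"

text \<open>
  A Riemannian metric on a manifold with smooth atlas \<open>A\<close> is given by its matrix \<open>g c\<close> in every
  chart \<open>c\<close> of \<open>A\<close>, as a function of the coordinates; \<open>metric_compatible\<close> says that these
  matrices represent the same inner products on the tangent spaces. All charts map onto open
  subsets of \<open>real^'n\<close>, so there is no boundary. The manifold need not be connected.
\<close>

locale compact_riemannian_manifold =
  fixes A :: "('a::{t2_space, second_countable_topology}, 'n::finite) chart set"
    and g :: "('a, 'n) chart \<Rightarrow> real^'n \<Rightarrow> real^'n^'n"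
  assumes compact_space: "compact (UNIV :: 'a set)"
    and charts: "\<And>c. c \<in> A \<Longrightarrow> is_chart c"
    and charts_cover: "(\<Union>c\<in>A. fst c) = UNIV"
    and transition_smooth:
      "\<And>c d. c \<in> A \<Longrightarrow> d \<in> A \<Longrightarrow> smooth_on (snd c ` (fst c \<inter> fst d)) (transition c d)"
    and metric_smooth: "\<And>c. c \<in> A \<Longrightarrow> smooth_on (chart_image c) (g c)"
    and metric_sym: "\<And>c x. c \<in> A \<Longrightarrow> x \<in> chart_image c \<Longrightarrow> transpose (g c x) = g c x"
    and metric_pos:
      "\<And>c x v. c \<in> A \<Longrightarrow> x \<in> chart_image c \<Longrightarrow> v \<noteq> 0 \<Longrightarrow> metric_ip (g c) x v v > 0"
    and metric_compatible:
      "\<And>c d x v w. c \<in> A \<Longrightarrow> d \<in> A \<Longrightarrow> x \<in> snd c ` (fst c \<inter> fst d) \<Longrightarrow>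
         metric_ip (g c) x v w =
         metric_ip (g d) (transition c d x)
           (frechet_derivative (transition c d) (at x) v)
           (frechet_derivative (transition c d) (at x) w)"

definition ricci_ge ::
    "('a, 'n::finite) chart set \<Rightarrow> (('a, 'n) chart \<Rightarrow> real^'n \<Rightarrow> real^'n^'n) \<Rightarrow> real \<Rightarrow> bool" where
  "ricci_ge A g \<kappa> \<longleftrightarrow>
     (\<forall>c\<in>A. \<forall>x\<in>chart_image c. \<forall>v. ricci (g c) x v v \<ge> \<kappa> * metric_ip (g c) x v v)"

text \<open>
  The values at the point \<open>p\<close> of the Laplace-Beltrami operator applied to \<open>f\<close> and of the squared
  length of the gradient of \<open>f\<close>, computed in a chart \<open>c\<close> around \<open>p\<close>. Both are independent of \<open>c\<close>;
  instead of choosing a chart, statements quantify over all charts around \<open>p\<close>.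
\<close>

definition laplace_beltrami ::
    "(('a, 'n::finite) chart \<Rightarrow> real^'n \<Rightarrow> real^'n^'n) \<Rightarrow> ('a, 'n) chart \<Rightarrow> ('a \<Rightarrow> real) \<Rightarrow> 'a \<Rightarrow> real" where
  "laplace_beltrami g c f p = laplacian (g c) (f \<circ> chart_inv c) (snd c p)"

definition grad_norm_sq ::
    "(('a, 'n::finite) chart \<Rightarrow> real^'n \<Rightarrow> real^'n^'n) \<Rightarrow> ('a, 'n) chart \<Rightarrow> ('a \<Rightarrow> real) \<Rightarrow> 'a \<Rightarrow> real" where
  "grad_norm_sq g c f p =
     (let X = grad (g c) (f \<circ> chart_inv c) (snd c p) in metric_ip (g c) (snd c p) X X)"

text \<open>A classical solution on \<open>M \<times> (0, \<infinity>)\<close>, jointly smooth in space and time; nothing is assumed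
  about the behaviour as \<open>t\<close> tends to \<open>0\<close>.\<close>

definition heat_solution ::
    "('a, 'n::finite) chart set \<Rightarrow> (('a, 'n) chart \<Rightarrow> real^'n \<Rightarrow> real^'n^'n) \<Rightarrow> ('a \<Rightarrow> real \<Rightarrow> real) \<Rightarrow> bool" where
  "heat_solution A g u \<longleftrightarrow>
     (\<forall>c\<in>A. smooth_on (chart_image c \<times> {0<..}) (\<lambda>(x, t). u (chart_inv c x) t)) \<and>
     (\<forall>c\<in>A. \<forall>p\<in>fst c. \<forall>t>0.
        ((\<lambda>s. u p s) has_real_derivative laplace_beltrami g c (\<lambda>q. u q t) p) (at t))"

end

theory Submission
  imports Defs
begin

text \<open>
  Put \<open>f = ln u\<close>, \<open>Q = |\<nabla>f|\<^sup>2\<close> and \<open>w = f\<^sub>t\<close>, so that \<open>w = \<Delta>f + Q\<close>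
  (\<open>log_heat_equation\<close>). Let \<open>\<alpha>\<close> be the coefficient of \<open>f\<^sub>t\<close> in the estimate and \<open>c\<close> its right-hand side. The claim, multiplied by
  \<open>a(t)\<close>, reads \<open>F \<le> 0\<close> for \<open>F = a Q - B w - E\<close> with \<open>B = a \<alpha> = 2K \<integral> a + a\<close> and \<open>E = a c\<close>. The point of the
  choice of \<open>\<alpha>\<close> and \<open>c\<close> is that \<open>B' = 2K a + a'\<close> and \<open>E' = n B'\<^sup>2 / (8a)\<close>.

  Suppose that \<open>F(\<sqdot>, t)\<close> is maximal at \<open>q\<close>. There \<open>a \<nabla>Q = B \<nabla>w\<close> and \<open>a \<Delta>Q \<le> B \<Delta>w\<close>. Since
  \<open>w\<^sub>t = \<Delta>w + 2\<langle>\<nabla>f, \<nabla>w\<rangle>\<close> and \<open>Q\<^sub>t = 2\<langle>\<nabla>f, \<nabla>w\<rangle>\<close>, Bochner's formula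
  \<open>\<Delta>Q = 2|\<nabla>\<^sup>2f|\<^sup>2 + 2\<langle>\<nabla>f, \<nabla>\<Delta>f\<rangle> + 2 Ric(\<nabla>f, \<nabla>f)\<close> together with \<open>n |\<nabla>\<^sup>2f|\<^sup>2 \<ge> (\<Delta>f)\<^sup>2\<close> and the bound on the
  Ricci curvature makes everything cancel except a quadratic polynomial in \<open>\<Delta>f\<close>:
  \<open>F\<^sub>t \<le> - B' \<Delta>f - (2a/n) (\<Delta>f)\<^sup>2 - E' \<le> 0\<close> at \<open>(q, t)\<close>. This is \<open>derivative_at_max_le\<close>, which
  rests on \<open>bochner_inequality\<close> and \<open>laplacian_at_max\<close>. Hence the maximum of \<open>F\<close> over
  the compact manifold cannot become positive if its upper limit as \<open>t \<rightarrow> 0\<close> is not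
  (\<open>parabolic_max_principle\<close>).

  Nothing is known about \<open>u\<close> near \<open>t = 0\<close>. The argument is therefore applied to the translates
  \<open>u(\<sqdot>, t + \<epsilon>)\<close>: their \<open>Q\<close> and \<open>w\<close> are bounded for \<open>0 < t \<le> 1\<close>, while \<open>a\<close>, \<open>B\<close> and \<open>E\<close> tend to \<open>0\<close>
  (\<open>log_gradient_bound_shifted\<close>). The estimate for \<open>u\<close> follows as \<open>\<epsilon> \<rightarrow> 0\<close> (\<open>log_gradient_bound\<close>).

  All differential geometry is done with components in one chart; the only global fact needed is
  that \<open>|\<nabla>f|\<^sup>2\<close> does not depend on the chart (\<open>grad_norm_sq_chart_independent\<close>), which makes \<open>F\<close> a
  function on the manifold whose maximum can be examined in any chart.
\<close>

section \<open>Calculus of smooth functions\<close>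

abbreviation dir_deriv ::
    "'a::euclidean_space \<Rightarrow> ('a \<Rightarrow> 'b::real_normed_vector) \<Rightarrow> 'a \<Rightarrow> 'b" where
  "dir_deriv v f \<equiv> \<lambda>x. frechet_derivative f (at x) v"

lemma dir_deriv_eqI: "(f has_derivative f') (at x) \<Longrightarrow> dir_deriv v f x = f' v"
  using frechet_derivative_at by metis

lemma dir_deriv_cong:
  assumes "open S" "x \<in> S" "\<And>y. y \<in> S \<Longrightarrow> f y = h y"
  shows "dir_deriv v f x = dir_deriv v h x"
proof -
  have "(f has_derivative f') (at x) \<longleftrightarrow> (h has_derivative f') (at x)" for f'
    using has_derivative_transform_within_open[OF _ assms(1,2), of f f' UNIV h]
      has_derivative_transform_within_open[OF _ assms(1,2), of h f' UNIV f] assms(3) by auto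
  then show ?thesis by (simp add: frechet_derivative_def)
qed

lemma Ck_on_cong:
  assumes "open S" "\<And>y. y \<in> S \<Longrightarrow> f y = h y" "Ck_on k S f"
  shows "Ck_on k S h"
  using assms
proof (induction k arbitrary: f h)
  case 0
  then show ?case using continuous_on_cong[of S S f h] by simp
next
  case (Suc k)
  have "h differentiable (at x)" if "x \<in> S" for x
  proof -
    have "f differentiable (at x)" using that Suc.prems(3) by simp
    then show ?thesis
      using that Suc.prems(1,2) unfolding differentiable_def
      using has_derivative_transform_within_open[of f _ x UNIV S h] by auto
  qed
  moreover have "Ck_on k S (dir_deriv v h)" for v
  proof (rule Suc.IH[OF Suc.prems(1)])
    show "Ck_on k S (dir_deriv v f)" using Suc.prems(3) by simp
    show "dir_deriv v f y = dir_deriv v h y" if "y \<in> S" for y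
      using dir_deriv_cong[OF Suc.prems(1) that Suc.prems(2)] .
  qed
  ultimately show ?case by simp
qed

lemma Ck_on_Suc_D: "Ck_on (Suc k) S f \<Longrightarrow> Ck_on k S f"
proof (induction k arbitrary: f)
  case 0
  then show ?case
    by (auto intro!: continuous_at_imp_continuous_on differentiable_imp_continuous_within)
next
  case (Suc k)
  have "f differentiable (at x)" if "x \<in> S" for x
    using Suc.prems that by (subst (asm) Ck_on.simps) blast
  moreover have "Ck_on k S (dir_deriv v f)" for v
    using Suc.prems by (intro Suc.IH) (subst (asm) Ck_on.simps, blast)
  ultimately show ?case by simp
qed

lemma smooth_on_cong:
  assumes "open S" "\<And>y. y \<in> S \<Longrightarrow> f y = h y" "smooth_on S f"
  shows "smooth_on S h"
proof -
  have "Ck_on k S h" for k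
    by (rule Ck_on_cong[OF assms(1,2)]) (use assms(3) in \<open>simp_all add: smooth_on_def\<close>)
  then show ?thesis by (simp add: smooth_on_def)
qed

lemma smooth_on_differentiable:
  assumes "smooth_on S f" "x \<in> S"
  shows "f differentiable (at x)"
proof -
  have "Ck_on (Suc 0) S f" using assms(1) unfolding smooth_on_def by blast
  then show ?thesis using assms(2) by simp
qed

lemma smooth_on_has_derivative:
  "smooth_on S f \<Longrightarrow> x \<in> S \<Longrightarrow> (f has_derivative (\<lambda>v. dir_deriv v f x)) (at x)"
  using smooth_on_differentiable frechet_derivative_works by blast

lemma smooth_on_dir_deriv:
  assumes "smooth_on S f"
  shows "smooth_on S (dir_deriv v f)"
proof -
  have "Ck_on (Suc k) S f" for k using assms unfolding smooth_on_def by blast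
  then show ?thesis by (simp add: smooth_on_def)
qed

lemma smooth_on_continuous:
  assumes "smooth_on S f"
  shows "continuous_on S f"
proof -
  have "Ck_on 0 S f" using assms unfolding smooth_on_def by blast
  then show ?thesis by simp
qed

lemma Ck_on_const: "Ck_on k S (\<lambda>x. c)"
  by (induction k arbitrary: c) auto

lemma Ck_on_add:
  assumes "open S" "Ck_on k S f" "Ck_on k S h"
  shows "Ck_on k S (\<lambda>x. f x + h x)"
  using assms
proof (induction k arbitrary: f h)
  case 0
  then show ?case by (auto intro: continuous_on_add)
next
  case (Suc k)
  have "Ck_on k S (dir_deriv v (\<lambda>x. f x + h x))" for v
  proof (rule Ck_on_cong[OF \<open>open S\<close>])
    show "Ck_on k S (\<lambda>x. dir_deriv v f x + dir_deriv v h x)"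
      using Suc by simp
    show "dir_deriv v f y + dir_deriv v h y = dir_deriv v (\<lambda>x. f x + h x) y" if "y \<in> S" for y
      using that Suc.prems
      by (intro dir_deriv_eqI[symmetric] has_derivative_add) (auto simp: frechet_derivative_works)
  qed
  then show ?case using Suc.prems by auto
qed

lemma Ck_on_mult:
  fixes f h :: "'a::euclidean_space \<Rightarrow> real"
  assumes "open S" "Ck_on k S f" "Ck_on k S h"
  shows "Ck_on k S (\<lambda>x. f x * h x)"
  using assms
proof (induction k arbitrary: f h)
  case 0
  then show ?case by (auto intro: continuous_on_mult)
next
  case (Suc k)
  have "Ck_on k S (dir_deriv v (\<lambda>x. f x * h x))" for v
  proof (rule Ck_on_cong[OF \<open>open S\<close>])
    show "Ck_on k S (\<lambda>x. f x * dir_deriv v h x + dir_deriv v f x * h x)"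
      using Suc.prems Suc.IH Ck_on_Suc_D[of k S f] Ck_on_Suc_D[of k S h] \<open>open S\<close>
      by (intro Ck_on_add) auto
    show "f y * dir_deriv v h y + dir_deriv v f y * h y = dir_deriv v (\<lambda>x. f x * h x) y"
      if "y \<in> S" for y
      using that Suc.prems
      by (intro dir_deriv_eqI[symmetric] has_derivative_mult) (auto simp: frechet_derivative_works)
  qed
  then show ?case using Suc.prems by auto
qed

lemma Ck_on_inverse:
  fixes f :: "'a::euclidean_space \<Rightarrow> real"
  assumes "open S" "Ck_on k S f" "\<And>x. x \<in> S \<Longrightarrow> f x \<noteq> 0"
  shows "Ck_on k S (\<lambda>x. inverse (f x))"
  using assms
proof (induction k arbitrary: f)
  case 0
  then show ?case by (auto intro: continuous_on_inverse)
next
  case (Suc k)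
  have inv: "Ck_on k S (\<lambda>x. inverse (f x))"
    using Suc Ck_on_Suc_D by blast
  have "Ck_on k S (dir_deriv v (\<lambda>x. inverse (f x)))" for v
  proof (rule Ck_on_cong[OF \<open>open S\<close>])
    show "Ck_on k S (\<lambda>x. (- 1) * (inverse (f x) * dir_deriv v f x * inverse (f x)))"
      using Suc.prems inv by (intro Ck_on_mult Ck_on_const) auto
    show "(- 1) * (inverse (f y) * dir_deriv v f y * inverse (f y))
        = dir_deriv v (\<lambda>x. inverse (f x)) y" if "y \<in> S" for y
    proof -
      have "(f has_derivative frechet_derivative f (at y)) (at y)"
        using that Suc.prems by (simp add: frechet_derivative_works)
      from Deriv.has_derivative_inverse[OF _ this] show ?thesis
        using dir_deriv_eqI that Suc.prems by fastforce
    qed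
  qed
  moreover have "(\<lambda>x. inverse (f x)) differentiable (at x)" if "x \<in> S" for x
    using that Suc.prems by (intro differentiable_inverse) auto
  ultimately show ?case by auto
qed

lemma smooth_on_const: "smooth_on S (\<lambda>x. c)"
  by (simp add: smooth_on_def Ck_on_const)

lemma smooth_on_add:
  "open S \<Longrightarrow> smooth_on S f \<Longrightarrow> smooth_on S h \<Longrightarrow> smooth_on S (\<lambda>x. f x + h x)"
  by (simp add: smooth_on_def Ck_on_add)

lemma smooth_on_mult:
  fixes f h :: "'a::euclidean_space \<Rightarrow> real"
  shows "open S \<Longrightarrow> smooth_on S f \<Longrightarrow> smooth_on S h \<Longrightarrow> smooth_on S (\<lambda>x. f x * h x)"
  by (simp add: smooth_on_def Ck_on_mult)

lemma smooth_on_inverse: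
  fixes f :: "'a::euclidean_space \<Rightarrow> real"
  shows "open S \<Longrightarrow> smooth_on S f \<Longrightarrow> (\<And>x. x \<in> S \<Longrightarrow> f x \<noteq> 0) \<Longrightarrow> smooth_on S (\<lambda>x. inverse (f x))"
  by (simp add: smooth_on_def Ck_on_inverse)

lemma smooth_on_diff:
  fixes f h :: "'a::euclidean_space \<Rightarrow> real"
  assumes "open S" "smooth_on S f" "smooth_on S h"
  shows "smooth_on S (\<lambda>x. f x - h x)"
proof -
  have "smooth_on S (\<lambda>x. f x + (- 1) * h x)"
    using assms by (intro smooth_on_add smooth_on_mult smooth_on_const)
  then show ?thesis by simp
qed

lemma smooth_on_sum:
  assumes "open S" "\<And>i. i \<in> I \<Longrightarrow> smooth_on S (f i)"
  shows "smooth_on S (\<lambda>x. \<Sum>i\<in>I. f i x)"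
  using assms(2)
proof (induction I rule: infinite_finite_induct)
  case (insert i I)
  then show ?case using assms(1) by (simp add: smooth_on_add)
qed (auto simp: smooth_on_const)

lemma smooth_on_prod:
  fixes f :: "'i \<Rightarrow> 'a::euclidean_space \<Rightarrow> real"
  assumes "open S" "\<And>i. i \<in> I \<Longrightarrow> smooth_on S (f i)"
  shows "smooth_on S (\<lambda>x. \<Prod>i\<in>I. f i x)"
  using assms(2)
proof (induction I rule: infinite_finite_induct)
  case (insert i I)
  then show ?case using assms(1) by (simp add: smooth_on_mult)
qed (auto simp: smooth_on_const)

text \<open>The derivative of the logarithm is rational, so closure under inverses and products
  gives closure under the logarithm.\<close>

lemma smooth_on_ln:
  fixes f :: "'a::euclidean_space \<Rightarrow> real"
  assumes "open S" "smooth_on S f" "\<And>x. x \<in> S \<Longrightarrow> f x > 0"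
  shows "smooth_on S (\<lambda>x. ln (f x))"
proof -
  have der: "((\<lambda>x. ln (f x)) has_derivative (\<lambda>v. dir_deriv v f y * inverse (f y))) (at y)"
    if "y \<in> S" for y
    using has_derivative_ln[OF assms(3)[OF that] smooth_on_has_derivative[OF assms(2) that]] .
  have "smooth_on S (\<lambda>x. dir_deriv v f x * inverse (f x))" for v
    using assms by (intro smooth_on_mult smooth_on_inverse smooth_on_dir_deriv) (auto simp: less_imp_neq[THEN not_sym])
  then have "smooth_on S (dir_deriv v (\<lambda>x. ln (f x)))" for v
    using smooth_on_cong[OF \<open>open S\<close>, of "\<lambda>x. dir_deriv v f x * inverse (f x)" "dir_deriv v (\<lambda>x. ln (f x))"]
    by (simp add: dir_deriv_eqI[OF der])
  moreover have "(\<lambda>x. ln (f x)) differentiable (at y)" if "y \<in> S" for y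
    using der[OF that] differentiableI by blast
  ultimately have "Ck_on (Suc k) S (\<lambda>x. ln (f x))" for k
    by (auto simp: smooth_on_def)
  from Ck_on_Suc_D[OF this] show ?thesis
    unfolding smooth_on_def by blast
qed

lemma Ck_on_compose_affine:
  assumes "bounded_linear L" "\<And>x. x \<in> S \<Longrightarrow> L x + b \<in> S'" "Ck_on k S' f" "open S"
  shows "Ck_on k S (\<lambda>x. f (L x + b))"
  using assms(3)
proof (induction k arbitrary: f)
  case 0
  have "continuous_on S (\<lambda>x. L x + b)"
    using assms(1) by (intro continuous_intros linear_continuous_on)
  then show ?case
    using 0 assms(2) by (auto intro: continuous_on_compose2)
next
  case (Suc k)
  have der: "((\<lambda>x. f (L x + b)) has_derivative (\<lambda>v. dir_deriv (L v) f (L y + b))) (at y)"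
    if "y \<in> S" for y
  proof -
    have "((\<lambda>x. L x + b) has_derivative L) (at y)"
      using has_derivative_add_const[OF bounded_linear_imp_has_derivative[OF assms(1)]] .
    moreover have "(f has_derivative frechet_derivative f (at (L y + b))) (at (L y + b))"
      using Suc.prems assms(2)[OF that] by (simp add: frechet_derivative_works)
    ultimately show ?thesis
      using diff_chain_at[of "\<lambda>x. L x + b" L y f] by (simp add: o_def)
  qed
  have "Ck_on k S (dir_deriv v (\<lambda>x. f (L x + b)))" for v
    by (rule Ck_on_cong[OF assms(4) _ Suc.IH[of "dir_deriv (L v) f"]])
      (use Suc.prems in \<open>auto simp: dir_deriv_eqI[OF der]\<close>)
  moreover have "(\<lambda>x. f (L x + b)) differentiable (at y)" if "y \<in> S" for y
    using der[OF that] differentiableI by blast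
  ultimately show ?case by auto
qed

lemma Ck_on_linear_compose:
  assumes "bounded_linear L" "Ck_on k S f" "open S"
  shows "Ck_on k S (\<lambda>x. L (f x))"
  using assms(2)
proof (induction k arbitrary: f)
  case 0
  then show ?case
    using assms(1) by (auto intro: bounded_linear.continuous_on)
next
  case (Suc k)
  have der: "((\<lambda>x. L (f x)) has_derivative (\<lambda>v. L (dir_deriv v f y))) (at y)" if "y \<in> S" for y
    using bounded_linear.has_derivative[OF assms(1)] Suc.prems that
    by (auto simp: frechet_derivative_works)
  have "Ck_on k S (dir_deriv v (\<lambda>x. L (f x)))" for v
    by (rule Ck_on_cong[OF assms(3) _ Suc.IH[of "dir_deriv v f"]])
      (use Suc.prems in \<open>auto simp: dir_deriv_eqI[OF der]\<close>)
  moreover have "(\<lambda>x. L (f x)) differentiable (at y)" if "y \<in> S" for y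
    using der[OF that] differentiableI by blast
  ultimately show ?case by auto
qed

lemma smooth_on_matrix_entry:
  fixes G :: "'a::euclidean_space \<Rightarrow> real^'n^'m"
  assumes "smooth_on S G" "open S"
  shows "smooth_on S (\<lambda>x. G x $ i $ j)"
proof -
  have "bounded_linear (\<lambda>M :: real^'n^'m. M $ i $ j)"
    using bounded_linear_compose[OF bounded_linear_vec_nth bounded_linear_vec_nth] .
  then have "Ck_on k S (\<lambda>x. G x $ i $ j)" for k
    by (rule Ck_on_linear_compose) (use assms in \<open>simp_all add: smooth_on_def\<close>)
  then show ?thesis by (simp add: smooth_on_def)
qed

lemma smooth_on_compose_fst:
  assumes "smooth_on S f" "open S" "open T"
  shows "smooth_on (S \<times> T) (\<lambda>z. f (fst z))"
proof -
  have "Ck_on k (S \<times> T) (\<lambda>z. f (fst z + 0))" for k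
    by (rule Ck_on_compose_affine[OF bounded_linear_fst, where S' = S])
      (use assms in \<open>auto simp: smooth_on_def open_Times\<close>)
  then show ?thesis by (simp add: smooth_on_def)
qed

lemma smooth_on_slice:
  assumes "smooth_on (S \<times> T) h" "open S" "t \<in> T"
  shows "smooth_on S (\<lambda>x. h (x, t))"
proof -
  have "bounded_linear (\<lambda>x. (x, 0))"
    by (intro bounded_linear_Pair bounded_linear_ident bounded_linear_zero)
  then have "Ck_on k S (\<lambda>x. h ((x, 0) + (0, t)))" for k
    by (rule Ck_on_compose_affine[where S' = "S \<times> T"]) (use assms in \<open>auto simp: smooth_on_def\<close>)
  then show ?thesis by (simp add: smooth_on_def)
qed

subsection \<open>Symmetry of second derivatives\<close>

lemma has_real_derivative_along_line:
  fixes f :: "'a::euclidean_space \<Rightarrow> real"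
  assumes "f differentiable (at (y + s *\<^sub>R v))"
  shows "((\<lambda>s. f (y + s *\<^sub>R v)) has_real_derivative dir_deriv v f (y + s *\<^sub>R v)) (at s)"
proof -
  have "((\<lambda>s. y + s *\<^sub>R v) has_derivative (\<lambda>h. h *\<^sub>R v)) (at s)"
    by (auto intro!: derivative_eq_intros)
  from diff_chain_at[OF this assms[unfolded frechet_derivative_works]]
  have "((\<lambda>s. f (y + s *\<^sub>R v)) has_derivative (\<lambda>h. dir_deriv (h *\<^sub>R v) f (y + s *\<^sub>R v))) (at s)"
    by (simp add: o_def)
  moreover have "dir_deriv (h *\<^sub>R v) f (y + s *\<^sub>R v) = dir_deriv v f (y + s *\<^sub>R v) * h" for h
    using linear_cmul[OF linear_frechet_derivative[OF assms]] by simp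
  ultimately show ?thesis
    by (simp add: has_field_derivative_def)
qed

text \<open>Two applications of the mean value theorem express the second difference of \<open>f\<close> over a
  small parallelogram by a second derivative at some point of that parallelogram.\<close>

lemma second_difference_mean_value:
  fixes f :: "'a::euclidean_space \<Rightarrow> real"
  assumes sm: "smooth_on S f" and h: "h > 0"
    and sub: "\<And>s t. 0 \<le> s \<Longrightarrow> s \<le> h \<Longrightarrow> 0 \<le> t \<Longrightarrow> t \<le> h \<Longrightarrow> x + s *\<^sub>R v + t *\<^sub>R w \<in> S"
  shows "\<exists>s t. 0 < s \<and> s < h \<and> 0 < t \<and> t < h \<and>
    f (x + h *\<^sub>R v + h *\<^sub>R w) - f (x + h *\<^sub>R v) - f (x + h *\<^sub>R w) + f x
      = h * h * dir_deriv w (dir_deriv v f) (x + s *\<^sub>R v + t *\<^sub>R w)"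
proof -
  let ?g = "\<lambda>s. f ((x + h *\<^sub>R w) + s *\<^sub>R v) - f (x + s *\<^sub>R v)"
  have df: "f differentiable (at y)" and ddf: "dir_deriv v f differentiable (at y)" if "y \<in> S" for y
    using smooth_on_differentiable[OF sm that]
      smooth_on_differentiable[OF smooth_on_dir_deriv[OF sm] that] by auto
  have "(?g has_real_derivative dir_deriv v f ((x + h *\<^sub>R w) + s *\<^sub>R v) - dir_deriv v f (x + s *\<^sub>R v)) (at s)"
    if "0 \<le> s" "s \<le> h" for s
    using sub[OF that, of h] sub[OF that, of 0] h
    by (intro DERIV_diff has_real_derivative_along_line df) (auto simp: add_ac)
  from MVT2[OF h this] obtain s where s: "0 < s" "s < h"
    and 1: "?g h - ?g 0 = h * (dir_deriv v f ((x + h *\<^sub>R w) + s *\<^sub>R v) - dir_deriv v f (x + s *\<^sub>R v))"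
    by auto
  have "((\<lambda>t. dir_deriv v f ((x + s *\<^sub>R v) + t *\<^sub>R w)) has_real_derivative
      dir_deriv w (dir_deriv v f) ((x + s *\<^sub>R v) + t *\<^sub>R w)) (at t)" if "0 \<le> t" "t \<le> h" for t
    using sub[of s t] that s by (intro has_real_derivative_along_line ddf) auto
  from MVT2[OF h this] obtain t where t: "0 < t" "t < h"
    and 2: "dir_deriv v f ((x + s *\<^sub>R v) + h *\<^sub>R w) - dir_deriv v f ((x + s *\<^sub>R v) + 0 *\<^sub>R w)
      = h * dir_deriv w (dir_deriv v f) ((x + s *\<^sub>R v) + t *\<^sub>R w)"
    by auto
  have "f (x + h *\<^sub>R v + h *\<^sub>R w) - f (x + h *\<^sub>R v) - f (x + h *\<^sub>R w) + f x = ?g h - ?g 0"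
    by (simp add: add_ac)
  also have "\<dots> = h * h * dir_deriv w (dir_deriv v f) (x + s *\<^sub>R v + t *\<^sub>R w)"
    using 1 2 by (simp add: add_ac)
  finally show ?thesis using s t by blast
qed

text \<open>The second difference over a parallelogram is symmetric in its two sides, so the mean value
  expressions for the two orders of differentiation agree at nearby points; continuity at \<open>x\<close>
  finishes the proof.\<close>

lemma dir_deriv_commute:
  fixes f :: "'a::euclidean_space \<Rightarrow> real"
  assumes S: "open S" "x \<in> S" and sm: "smooth_on S f"
  shows "dir_deriv v (dir_deriv w f) x = dir_deriv w (dir_deriv v f) x"
proof (rule ccontr)
  let ?p = "dir_deriv v (dir_deriv w f)" and ?q = "dir_deriv w (dir_deriv v f)"
  assume ne: "?p x \<noteq> ?q x"
  define e where "e = \<bar>?p x - ?q x\<bar> / 2"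
  have e: "e > 0" using ne by (simp add: e_def)
  have "continuous_on S ?p" "continuous_on S ?q"
    by (intro smooth_on_continuous smooth_on_dir_deriv sm)+
  then have "isCont ?p x" "isCont ?q x"
    using S continuous_on_eq_continuous_at by blast+
  then have "(?p \<longlongrightarrow> ?p x) (nhds x)" "(?q \<longlongrightarrow> ?q x) (nhds x)"
    using tendsto_at_iff_tendsto_nhds[of ?p x] tendsto_at_iff_tendsto_nhds[of ?q x]
    by (simp_all only: isCont_def)
  then have "\<forall>\<^sub>F y in nhds x. dist (?p y) (?p x) < e" "\<forall>\<^sub>F y in nhds x. dist (?q y) (?q x) < e"
    using tendstoD e by blast+
  moreover have "\<forall>\<^sub>F y in nhds x. y \<in> S" using S eventually_nhds by blast
  ultimately have "\<forall>\<^sub>F y in nhds x. dist (?p y) (?p x) < e \<and> dist (?q y) (?q x) < e \<and> y \<in> S"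
    by (simp add: eventually_conj)
  then obtain d where d: "d > 0"
    and near: "\<And>y. dist y x < d \<Longrightarrow> dist (?p y) (?p x) < e \<and> dist (?q y) (?q x) < e \<and> y \<in> S"
    by (auto simp: eventually_nhds_metric)
  define h where "h = d / (2 * (norm v + norm w + 1))"
  have pos: "norm v + norm w + 1 > 0" by (smt (verit) norm_ge_zero)
  have h: "h > 0" using d pos by (simp add: h_def)
  have close: "dist (x + s *\<^sub>R v + t *\<^sub>R w) x < d" if "0 \<le> s" "s \<le> h" "0 \<le> t" "t \<le> h" for s t
  proof -
    have "norm (s *\<^sub>R v + t *\<^sub>R w) \<le> s * norm v + t * norm w"
      using norm_triangle_ineq[of "s *\<^sub>R v" "t *\<^sub>R w"] that by simp
    also have "\<dots> \<le> h * norm v + h * norm w"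
      using that by (intro add_mono mult_right_mono) auto
    also have "\<dots> \<le> h * (norm v + norm w + 1)" using h by (simp add: algebra_simps)
    also have "\<dots> = d / 2" using pos unfolding h_def by (simp add: field_split_simps)
    also have "\<dots> < d" using d by simp
    finally show ?thesis by (simp add: dist_norm add.assoc)
  qed
  obtain s t where st: "0 < s" "s < h" "0 < t" "t < h"
    and 1: "f (x + h *\<^sub>R v + h *\<^sub>R w) - f (x + h *\<^sub>R v) - f (x + h *\<^sub>R w) + f x
      = h * h * ?q (x + s *\<^sub>R v + t *\<^sub>R w)"
    using second_difference_mean_value[OF sm h, of x v w] near close by blast
  have sub': "x + s *\<^sub>R w + t *\<^sub>R v \<in> S" if "0 \<le> s" "s \<le> h" "0 \<le> t" "t \<le> h" for s t
    using near[OF close[of t s]] that by (simp add: add_ac)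
  obtain s' t' where st': "0 < s'" "s' < h" "0 < t'" "t' < h"
    and 2: "f (x + h *\<^sub>R w + h *\<^sub>R v) - f (x + h *\<^sub>R w) - f (x + h *\<^sub>R v) + f x
      = h * h * ?p (x + s' *\<^sub>R w + t' *\<^sub>R v)"
    using second_difference_mean_value[OF sm h, of x w v] sub' by blast
  have swap: "x + h *\<^sub>R w + h *\<^sub>R v = x + h *\<^sub>R v + h *\<^sub>R w"
    "x + s' *\<^sub>R w + t' *\<^sub>R v = x + t' *\<^sub>R v + s' *\<^sub>R w"
    by (simp_all add: add_ac)
  have "h * h * ?q (x + s *\<^sub>R v + t *\<^sub>R w) = h * h * ?p (x + t' *\<^sub>R v + s' *\<^sub>R w)"
    using 1 2[unfolded swap] by linarith
  then have "?q (x + s *\<^sub>R v + t *\<^sub>R w) = ?p (x + t' *\<^sub>R v + s' *\<^sub>R w)"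
    using h by simp
  moreover have "dist (?q (x + s *\<^sub>R v + t *\<^sub>R w)) (?q x) < e"
    using near[OF close[of s t]] st by simp
  moreover have "dist (?p (x + t' *\<^sub>R v + s' *\<^sub>R w)) (?p x) < e"
    using near[OF close[of t' s']] st' by simp
  ultimately show False
    unfolding e_def dist_real_def by argo
qed

section \<open>Positive definite matrices\<close>

text \<open>Gram--Schmidt, as an induction over a set \<open>I\<close> of indices: as long as \<open>I\<close> is not the whole index
  type, the vectors found so far cannot span the space.\<close>

lemma orthonormal_family:
  fixes ip :: "real^'n \<Rightarrow> real^'n \<Rightarrow> real"
  assumes bil: "bilinear ip" and sym: "\<And>v w. ip v w = ip w v"
    and pos: "\<And>v. v \<noteq> 0 \<Longrightarrow> ip v v > 0"
  shows "\<exists>e :: 'n \<Rightarrow> real^'n. \<forall>i\<in>I. \<forall>j\<in>I. ip (e i) (e j) = (if i = j then 1 else 0)"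
proof (induction I rule: infinite_finite_induct)
  case (insert k I)
  then obtain e where e: "\<And>i j. i \<in> I \<Longrightarrow> j \<in> I \<Longrightarrow> ip (e i) (e j) = (if i = j then 1 else 0)"
    by blast
  have "dim (e ` I) \<le> card (e ` I)" using insert.hyps(1) by (simp add: dim_le_card')
  also have "\<dots> \<le> card I" using insert.hyps(1) by (rule card_image_le)
  also have "\<dots> < card (UNIV :: 'n set)"
    using insert.hyps by (intro psubset_card_mono) auto
  finally have small: "dim (e ` I) < CARD('n)" .
  have "span (e ` I) \<noteq> UNIV"
  proof
    assume "span (e ` I) = UNIV"
    then have "dim (e ` I) = CARD('n)" using dim_span[of "e ` I"] by simp
    then show False using small by simp
  qed
  then obtain v where v: "v \<notin> span (e ` I)" by blast
  define w where "w = v - (\<Sum>j\<in>I. ip v (e j) *\<^sub>R e j)"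
  have "(\<Sum>j\<in>I. ip v (e j) *\<^sub>R e j) \<in> span (e ` I)"
    by (intro span_sum span_scale span_base) auto
  then have "w \<noteq> 0" using v by (auto simp: w_def)
  then have ww: "ip w w > 0" by (rule pos)
  have orth: "ip w (e i) = 0" if "i \<in> I" for i
  proof -
    have "ip w (e i) = ip v (e i) - (\<Sum>j\<in>I. ip v (e j) * ip (e j) (e i))"
      using bil unfolding w_def
      by (simp add: bilinear_lsub bilinear_def linear_sum[of "\<lambda>x. ip x (e i)"] linear_cmul[of "\<lambda>x. ip x (e i)"])
    also have "(\<Sum>j\<in>I. ip v (e j) * ip (e j) (e i)) = (\<Sum>j\<in>I. if j = i then ip v (e j) else 0)"
      using e that by (intro sum.cong) auto
    also have "\<dots> = ip v (e i)" using that insert.hyps by simp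
    finally show ?thesis by simp
  qed
  define f where "f = e(k := (1 / sqrt (ip w w)) *\<^sub>R w)"
  have "ip (f k) (f k) = 1"
    using ww bil by (simp add: f_def bilinear_lmul bilinear_rmul divide_simps)
  moreover have "ip (f k) (f i) = 0" "ip (f i) (f k) = 0" if "i \<in> I" for i
    using orth[OF that] sym[of w "e i"] that insert.hyps(2) bil
    by (auto simp: f_def bilinear_lmul bilinear_rmul)
  moreover have "f i = e i" if "i \<in> I" for i using that insert.hyps(2) by (auto simp: f_def)
  ultimately have "\<forall>i\<in>insert k I. \<forall>j\<in>insert k I. ip (f i) (f j) = (if i = j then 1 else 0)"
    using e insert.hyps(2) by auto
  then show ?case by blast
qed auto

lemma sum_rotate:
  fixes F :: "'i \<Rightarrow> 'j \<Rightarrow> 'k \<Rightarrow> real"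
  shows "(\<Sum>i\<in>I. \<Sum>j\<in>J. \<Sum>k\<in>L. F i j k) = (\<Sum>j\<in>J. \<Sum>k\<in>L. \<Sum>i\<in>I. F i j k)"
  by (subst sum.swap) (rule sum.cong[OF refl], rule sum.swap)

locale posdef_matrix =
  fixes M :: "real^'n^'n"
  assumes M_transpose: "transpose M = M"
    and M_pos: "\<And>v. v \<noteq> 0 \<Longrightarrow> v \<bullet> (M *v v) > 0"
begin

lemma M_sym: "M $ i $ j = M $ j $ i"
  using arg_cong[OF M_transpose, of "\<lambda>A. A $ i $ j"] by (simp add: transpose_def)

lemma M_invertible: "invertible M"
proof -
  have "M *v x = 0 \<Longrightarrow> x = 0" for x
    using M_pos[of x] by (metis inner_zero_right less_irrefl)
  then show ?thesis
    by (simp add: invertible_left_inverse matrix_left_invertible_ker)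
qed

lemma matrix_inv_both: "M ** matrix_inv M = mat 1" "matrix_inv M ** M = mat 1"
proof -
  have "M ** matrix_inv M = mat 1 \<and> matrix_inv M ** M = mat 1"
    using M_invertible unfolding invertible_def matrix_inv_def by (rule someI_ex)
  then show "M ** matrix_inv M = mat 1" "matrix_inv M ** M = mat 1" by auto
qed

lemma mult_inv_entry: "(\<Sum>k\<in>UNIV. M $ i $ k * matrix_inv M $ k $ j) = (if i = j then 1 else 0)"
  using matrix_inv_both(1) by (simp add: vec_eq_iff matrix_matrix_mult_def mat_def)

lemma inv_mult_entry: "(\<Sum>k\<in>UNIV. matrix_inv M $ i $ k * M $ k $ j) = (if i = j then 1 else 0)"
  using matrix_inv_both(2) by (simp add: vec_eq_iff matrix_matrix_mult_def mat_def)

lemma matrix_inv_transpose: "transpose (matrix_inv M) = matrix_inv M"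
proof -
  have "transpose (matrix_inv M) ** M = mat 1"
    using matrix_inv_both(1) M_transpose matrix_transpose_mul[of M "matrix_inv M"] by (simp add: transpose_mat)
  then have "transpose (matrix_inv M) ** (M ** matrix_inv M) = matrix_inv M"
    by (simp add: matrix_mul_assoc)
  then show ?thesis by (simp add: matrix_inv_both)
qed

lemma inv_sym: "matrix_inv M $ i $ j = matrix_inv M $ j $ i"
  using arg_cong[OF matrix_inv_transpose, of "\<lambda>A. A $ i $ j"] by (simp add: transpose_def)

lemma inner_M_sym: "v \<bullet> (M *v w) = w \<bullet> (M *v v)"
proof -
  have "v \<bullet> (M *v w) = (transpose M *v v) \<bullet> w"
    by (simp add: dot_lmul_matrix)
  then show ?thesis by (simp add: M_transpose inner_commute)
qed

text \<open>A frame that is orthonormal for the inner product of \<open>M\<close> factorizes the inverse of \<open>M\<close>; this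
  turns contractions with the inverse into sums over the frame.\<close>

lemma inverse_frame:
  obtains e :: "'n \<Rightarrow> real^'n"
  where "\<And>i j. matrix_inv M $ i $ j = (\<Sum>a\<in>UNIV. e a $ i * e a $ j)"
proof -
  have bil: "bilinear (\<lambda>v w. v \<bullet> (M *v w))"
    unfolding bilinear_def
    by (auto intro!: linearI simp: inner_left_distrib inner_right_distrib matrix_vector_right_distrib
        matrix_vector_mult_scaleR)
  obtain e :: "'n \<Rightarrow> real^'n" where e: "\<And>i j. e i \<bullet> (M *v e j) = (if i = j then 1 else 0)"
    using orthonormal_family[OF bil inner_M_sym M_pos, of UNIV] by auto
  define E where "E = (\<chi> i a. e a $ i)"
  have "transpose E ** (M ** E) = mat 1"
    using e
    by (simp add: vec_eq_iff E_def matrix_matrix_mult_def transpose_def mat_def inner_vec_def matrix_vector_mult_def)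
  then have "(M ** E) ** transpose E = mat 1" by (simp add: matrix_left_right_inverse)
  then have "matrix_inv M ** (M ** (E ** transpose E)) = matrix_inv M"
    by (simp add: matrix_mul_assoc)
  then have "E ** transpose E = matrix_inv M"
    by (simp add: matrix_mul_assoc matrix_inv_both)
  then have "matrix_inv M $ i $ j = (\<Sum>a\<in>UNIV. e a $ i * e a $ j)" for i j
    unfolding vec_eq_iff by (simp add: E_def matrix_matrix_mult_def transpose_def eq_commute)
  then show ?thesis by (rule that)
qed

text \<open>In an orthonormal frame the trace of \<open>N\<close> is a sum of diagonal entries of a symmetric matrix and
  the trace of \<open>N\<^sup>2\<close> is the sum of the squares of all its entries, so the Cauchy--Schwarz inequality
  applies.\<close>

lemma trace_square_le:
  fixes H N :: "'n \<Rightarrow> 'n \<Rightarrow> real"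
  assumes H: "\<And>i j. H i j = H j i"
    and N: "\<And>i j. N i j = (\<Sum>l\<in>UNIV. matrix_inv M $ j $ l * H i l)"
  shows "(\<Sum>i\<in>UNIV. N i i)\<^sup>2 \<le> real CARD('n) * (\<Sum>i\<in>UNIV. \<Sum>j\<in>UNIV. N i j * N j i)"
proof -
  obtain e :: "'n \<Rightarrow> real^'n" where e: "\<And>i j. matrix_inv M $ i $ j = (\<Sum>a\<in>UNIV. e a $ i * e a $ j)"
    by (rule inverse_frame) blast
  define B where "B a b = (\<Sum>i\<in>UNIV. \<Sum>l\<in>UNIV. e a $ i * H i l * e b $ l)" for a b
  have Bsym: "B a b = B b a" for a b
    unfolding B_def by (subst sum.swap) (simp add: H[of _ _] mult.commute mult.left_commute)
  have tr: "(\<Sum>i\<in>UNIV. N i i) = (\<Sum>a\<in>UNIV. B a a)"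
  proof -
    have "(\<Sum>i\<in>UNIV. N i i) = (\<Sum>i\<in>UNIV. \<Sum>l\<in>UNIV. \<Sum>a\<in>UNIV. e a $ i * H i l * e a $ l)"
      by (simp add: N e sum_distrib_left sum_distrib_right mult_ac)
    also have "\<dots> = (\<Sum>i\<in>UNIV. \<Sum>a\<in>UNIV. \<Sum>l\<in>UNIV. e a $ i * H i l * e a $ l)"
      by (intro sum.cong sum.swap refl)
    also have "\<dots> = (\<Sum>a\<in>UNIV. B a a)"
      unfolding B_def by (rule sum.swap)
    finally show ?thesis .
  qed
  define P where "P i b = (\<Sum>l\<in>UNIV. H i l * e b $ l)" for i b
  have N': "N i j = (\<Sum>a\<in>UNIV. e a $ j * P i a)" for i j
  proof -
    have "N i j = (\<Sum>l\<in>UNIV. \<Sum>a\<in>UNIV. e a $ j * (H i l * e a $ l))"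
      by (simp add: N e sum_distrib_left sum_distrib_right mult_ac)
    also have "\<dots> = (\<Sum>a\<in>UNIV. \<Sum>l\<in>UNIV. e a $ j * (H i l * e a $ l))"
      by (rule sum.swap)
    finally show ?thesis by (simp add: P_def sum_distrib_left)
  qed
  have B': "B a b = (\<Sum>i\<in>UNIV. e a $ i * P i b)" for a b
    by (simp add: B_def P_def sum_distrib_left mult.assoc)
  have "(\<Sum>i\<in>UNIV. \<Sum>j\<in>UNIV. N i j * N j i)
      = (\<Sum>i\<in>UNIV. \<Sum>j\<in>UNIV. \<Sum>a\<in>UNIV. \<Sum>b\<in>UNIV. (e b $ i * P i a) * (e a $ j * P j b))"
    unfolding N' sum_product by (intro sum.cong refl) (simp only: mult_ac)
  also have "\<dots> = (\<Sum>i\<in>UNIV. \<Sum>a\<in>UNIV. \<Sum>b\<in>UNIV. \<Sum>j\<in>UNIV. (e b $ i * P i a) * (e a $ j * P j b))"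
    by (rule sum.cong[OF refl], rule sum_rotate)
  also have "\<dots> = (\<Sum>a\<in>UNIV. \<Sum>b\<in>UNIV. \<Sum>i\<in>UNIV. \<Sum>j\<in>UNIV. (e b $ i * P i a) * (e a $ j * P j b))"
    by (rule sum_rotate)
  also have "\<dots> = (\<Sum>a\<in>UNIV. \<Sum>b\<in>UNIV. B b a * B a b)"
    unfolding B' sum_product ..
  also have "\<dots> = (\<Sum>a\<in>UNIV. \<Sum>b\<in>UNIV. (B a b)\<^sup>2)"
    using Bsym by (intro sum.cong refl) (metis power2_eq_square)
  finally have trsq: "(\<Sum>i\<in>UNIV. \<Sum>j\<in>UNIV. N i j * N j i) = (\<Sum>a\<in>UNIV. \<Sum>b\<in>UNIV. (B a b)\<^sup>2)" .
  have "(\<Sum>i\<in>UNIV. N i i)\<^sup>2 \<le> (\<Sum>a\<in>UNIV. (B a a)\<^sup>2) * real CARD('n)"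
    unfolding tr by (rule sum_squared_le_sum_of_squares)
  also have "\<dots> \<le> (\<Sum>a\<in>UNIV. \<Sum>b\<in>UNIV. (B a b)\<^sup>2) * real CARD('n)"
    by (intro mult_right_mono sum_mono member_le_sum[of _ UNIV "\<lambda>b. (B _ b)\<^sup>2"]) auto
  finally show ?thesis by (simp add: trsq mult.commute)
qed

end

section \<open>Riemannian geometry in one chart\<close>

lemma pd_dir_deriv: "pd i f = dir_deriv (axis i 1) f"
  by (simp add: fun_eq_iff pd_def)

lemma smooth_on_pd: "smooth_on S f \<Longrightarrow> smooth_on S (pd i f)"
  unfolding pd_dir_deriv by (rule smooth_on_dir_deriv)

lemma pd_cong:
  "open S \<Longrightarrow> x \<in> S \<Longrightarrow> (\<And>y. y \<in> S \<Longrightarrow> f y = h y) \<Longrightarrow> pd i f x = pd i h x"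
  unfolding pd_dir_deriv by (rule dir_deriv_cong)

lemma pd_commute:
  "open S \<Longrightarrow> x \<in> S \<Longrightarrow> smooth_on S f \<Longrightarrow> pd i (pd j f) x = pd j (pd i f) x"
  unfolding pd_dir_deriv by (rule dir_deriv_commute)

lemma pd_const: "pd i (\<lambda>y. c) x = 0"
  by (simp add: pd_def)

lemma pd_add:
  assumes "smooth_on S f" "smooth_on S h" "x \<in> S"
  shows "pd i (\<lambda>y. f y + h y) x = pd i f x + pd i h x"
  unfolding pd_def
  by (rule dir_deriv_eqI[OF has_derivative_add[OF smooth_on_has_derivative smooth_on_has_derivative]])
    (use assms in auto)

lemma pd_diff:
  assumes "smooth_on S f" "smooth_on S h" "x \<in> S"
  shows "pd i (\<lambda>y. f y - h y) x = pd i f x - pd i h x"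
  unfolding pd_def
  by (rule dir_deriv_eqI[OF has_derivative_diff[OF smooth_on_has_derivative smooth_on_has_derivative]])
    (use assms in auto)

lemma pd_mult:
  assumes "smooth_on S f" "smooth_on S h" "x \<in> S"
  shows "pd i (\<lambda>y. f y * h y) x = f x * pd i h x + pd i f x * h x"
  unfolding pd_def
  by (rule dir_deriv_eqI[OF has_derivative_mult[OF smooth_on_has_derivative smooth_on_has_derivative]])
    (use assms in auto)

lemma pd_cmult:
  assumes "smooth_on S f" "x \<in> S"
  shows "pd i (\<lambda>y. c * f y) x = c * pd i f x"
  using pd_mult[OF smooth_on_const assms] by (simp add: pd_const)

lemma pd_sum:
  assumes "\<And>k. k \<in> I \<Longrightarrow> smooth_on S (f k)" "x \<in> S"
  shows "pd i (\<lambda>y. \<Sum>k\<in>I. f k y) x = (\<Sum>k\<in>I. pd i (f k) x)"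
  unfolding pd_def
  by (rule dir_deriv_eqI[OF has_derivative_sum[OF smooth_on_has_derivative]])
    (use assms in auto)

lemma dir_deriv_sum_pd:
  fixes f :: "real^'n \<Rightarrow> real"
  assumes "f differentiable (at x)"
  shows "dir_deriv v f x = (\<Sum>i\<in>UNIV. v $ i * pd i f x)"
proof -
  have "frechet_derivative f (at x) v = frechet_derivative f (at x) (\<Sum>i\<in>UNIV. v $ i *\<^sub>R axis i 1)"
    using basis_expansion[of v] by (simp add: scalar_mult_eq_scaleR)
  also have "\<dots> = (\<Sum>i\<in>UNIV. v $ i * pd i f x)"
    using linear_frechet_derivative[OF assms] by (simp add: linear_sum linear_cmul pd_def)
  finally show ?thesis .
qed

text \<open>The component \<open>\<nabla>\<^sub>i X\<^sup>j\<close>, in this order of the indices.\<close>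

definition covariant_deriv ::
    "(real^'n \<Rightarrow> real^'n^'n) \<Rightarrow> (real^'n \<Rightarrow> real^'n) \<Rightarrow> 'n \<Rightarrow> 'n \<Rightarrow> real^'n::finite \<Rightarrow> real" where
  "covariant_deriv G X i j x =
     pd i (\<lambda>y. X y $ j) x + (\<Sum>k\<in>UNIV. christoffel G j i k x * X x $ k)"

text \<open>The covariant second derivative \<open>\<nabla>\<^sub>i \<nabla>\<^sub>j f\<close>.\<close>

definition hessian ::
    "(real^'n \<Rightarrow> real^'n^'n) \<Rightarrow> (real^'n \<Rightarrow> real) \<Rightarrow> 'n \<Rightarrow> 'n \<Rightarrow> real^'n::finite \<Rightarrow> real" where
  "hessian G f i j x = pd i (pd j f) x - (\<Sum>k\<in>UNIV. christoffel G k i j x * pd k f x)"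

text \<open>The inner product \<open>\<langle>\<nabla>f, \<nabla>h\<rangle>\<close>, written as the derivative of \<open>h\<close> along \<open>\<nabla>f\<close>: this form is linear in
  \<open>h\<close> on sight and contains the inverse metric only once.\<close>

definition grad_ip ::
    "(real^'n \<Rightarrow> real^'n^'n) \<Rightarrow> (real^'n \<Rightarrow> real) \<Rightarrow> (real^'n \<Rightarrow> real) \<Rightarrow> real^'n::finite \<Rightarrow> real" where
  "grad_ip G f h x = (\<Sum>j\<in>UNIV. grad G f x $ j * pd j h x)"

lemma laplacian_covariant_deriv:
  "laplacian G f x = (\<Sum>i\<in>UNIV. covariant_deriv G (grad G f) i i x)"
  by (simp add: laplacian_def divergence_def covariant_deriv_def)

lemma grad_component: "grad G f x $ j = (\<Sum>k\<in>UNIV. matrix_inv (G x) $ j $ k * pd k f x)"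
  by (simp add: grad_def matrix_vector_mult_def)

locale coordinate_metric =
  fixes S :: "(real^'n::finite) set" and G :: "real^'n \<Rightarrow> real^'n^'n"
  assumes open_S: "open S"
    and smooth_G: "smooth_on S G"
    and G_transpose: "x \<in> S \<Longrightarrow> transpose (G x) = G x"
    and G_pos: "x \<in> S \<Longrightarrow> v \<noteq> 0 \<Longrightarrow> metric_ip G x v v > 0"
begin

lemma posdef: "x \<in> S \<Longrightarrow> posdef_matrix (G x)"
  using G_transpose G_pos by unfold_locales (auto simp: metric_ip_def)

lemmas G_sym = posdef_matrix.M_sym[OF posdef]
lemmas Ginv_sym = posdef_matrix.inv_sym[OF posdef]

lemmas smooth_ops = open_S smooth_on_add[OF open_S] smooth_on_diff[OF open_S]
  smooth_on_mult[OF open_S] smooth_on_sum[OF open_S] smooth_on_const smooth_on_pd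

lemma smooth_G_entry: "smooth_on S (\<lambda>x. G x $ i $ j)"
  using smooth_on_matrix_entry[OF smooth_G open_S] .

text \<open>By Cramer's rule the entries of the inverse are quotients of determinants, hence rational
  functions of the entries of \<open>G\<close>.\<close>

lemma smooth_Ginv: "smooth_on S (\<lambda>x. matrix_inv (G x) $ k $ j)"
proof -
  \<comment> \<open>the matrix of the metric with column \<open>k\<close> replaced by the unit vector \<open>j\<close>\<close>
  define B where "B x = (\<chi> i l. if l = k then (axis j 1 :: real^'n) $ i else G x $ i $ l)" for x
  have det_smooth: "smooth_on S (\<lambda>x. det (A x :: real^'n^'n))"
    if "\<And>i l. smooth_on S (\<lambda>x. A x $ i $ l)" for A
    unfolding det_def using that
    by (intro smooth_ops smooth_on_prod) auto
  have "smooth_on S (\<lambda>x. B x $ i $ l)" for i l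
    by (cases "l = k") (simp_all add: B_def smooth_on_const smooth_G_entry)
  then have 1: "smooth_on S (\<lambda>x. det (B x))" by (rule det_smooth)
  have 2: "smooth_on S (\<lambda>x. det (G x))" using smooth_G_entry by (rule det_smooth)
  have nz: "det (G x) \<noteq> 0" if "x \<in> S" for x
    using posdef_matrix.M_invertible[OF posdef[OF that]] invertible_det_nz by blast
  have "det (B x) * inverse (det (G x)) = matrix_inv (G x) $ k $ j" if "x \<in> S" for x
  proof -
    have "G x *v (matrix_inv (G x) *v axis j 1) = axis j 1"
      using posdef_matrix.matrix_inv_both(1)[OF posdef[OF that]]
      by (simp add: matrix_vector_mul_assoc)
    then have "matrix_inv (G x) *v axis j 1
        = (\<chi> k. det (\<chi> i l. if l = k then (axis j 1 :: real^'n) $ i else G x $ i $ l) / det (G x))"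
      using cramer[OF nz[OF that]] by blast
    from arg_cong[OF this, of "\<lambda>v. v $ k"] show ?thesis
      by (simp add: B_def matrix_vector_mult_basis column_def divide_inverse)
  qed
  with smooth_on_mult[OF open_S 1 smooth_on_inverse[OF open_S 2 nz]] show ?thesis
    by (rule smooth_on_cong[OF open_S, rotated])
qed

lemma smooth_christoffel: "smooth_on S (christoffel G k i j)"
  unfolding christoffel_def [abs_def]
  by (intro smooth_ops smooth_Ginv smooth_G_entry)

lemma smooth_grad: "smooth_on S f \<Longrightarrow> smooth_on S (\<lambda>x. grad G f x $ j)"
  unfolding grad_component by (intro smooth_ops smooth_Ginv)

lemma smooth_covariant_deriv:
  "smooth_on S f \<Longrightarrow> smooth_on S (covariant_deriv G (grad G f) i j)"
  unfolding covariant_deriv_def [abs_def]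
  by (intro smooth_ops smooth_christoffel smooth_grad)

lemma smooth_laplacian: "smooth_on S f \<Longrightarrow> smooth_on S (laplacian G f)"
  unfolding laplacian_covariant_deriv [abs_def]
  by (intro smooth_ops smooth_covariant_deriv)

lemma smooth_grad_ip: "smooth_on S f \<Longrightarrow> smooth_on S h \<Longrightarrow> smooth_on S (grad_ip G f h)"
  unfolding grad_ip_def [abs_def]
  by (intro smooth_ops smooth_grad)

lemma grad_ip_sym:
  assumes "x \<in> S"
  shows "grad_ip G f h x = grad_ip G h f x"
proof -
  have "grad_ip G f h x = (\<Sum>j\<in>UNIV. \<Sum>k\<in>UNIV. matrix_inv (G x) $ j $ k * (pd k f x * pd j h x))"
    by (simp add: grad_ip_def grad_component sum_distrib_right mult.assoc)
  also have "\<dots> = (\<Sum>k\<in>UNIV. \<Sum>j\<in>UNIV. matrix_inv (G x) $ k $ j * (pd j h x * pd k f x))"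
    by (subst sum.swap) (simp add: Ginv_sym[OF assms, of _ k for k] mult.commute)
  also have "\<dots> = grad_ip G h f x"
    by (simp add: grad_ip_def grad_component sum_distrib_right mult.assoc)
  finally show ?thesis .
qed

lemma metric_ip_grad:
  assumes "x \<in> S"
  shows "metric_ip G x v (grad G f x) = (\<Sum>j\<in>UNIV. v $ j * pd j f x)"
proof -
  have "G x *v grad G f x = (\<chi> j. pd j f x)"
    using posdef_matrix.matrix_inv_both(1)[OF posdef[OF assms]]
    by (simp add: grad_def matrix_vector_mul_assoc)
  then show ?thesis by (simp add: metric_ip_def inner_vec_def)
qed

lemma metric_ip_grad_grad: "x \<in> S \<Longrightarrow> metric_ip G x (grad G f x) (grad G h x) = grad_ip G f h x"
  by (simp add: metric_ip_grad grad_ip_def)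

lemma pd_G_sym: "x \<in> S \<Longrightarrow> pd k (\<lambda>y. G y $ i $ j) x = pd k (\<lambda>y. G y $ j $ i) x"
  by (rule pd_cong[OF open_S]) (auto intro: G_sym)

lemma christoffel_sym: "x \<in> S \<Longrightarrow> christoffel G k i j x = christoffel G k j i x"
  unfolding christoffel_def by (simp add: pd_G_sym[of x _ i j] add.commute)

text \<open>This says that the inverse metric is parallel. The derivative of the metric is a sum of two
  Christoffel symbols of the first kind; differentiating the product of the metric with its inverse
  carries this over to the inverse.\<close>

lemma pd_Ginv:
  assumes x: "x \<in> S"
  shows "pd k (\<lambda>y. matrix_inv (G y) $ i $ j) x =
    - (\<Sum>l\<in>UNIV. christoffel G i k l x * matrix_inv (G x) $ l $ j)
    - (\<Sum>l\<in>UNIV. christoffel G j k l x * matrix_inv (G x) $ l $ i)"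
proof -
  interpret posdef_matrix "G x" using posdef[OF x] .
  let ?h = "\<lambda>i j. matrix_inv (G x) $ i $ j"
  let ?dh = "\<lambda>i j. pd k (\<lambda>y. matrix_inv (G y) $ i $ j) x"
  let ?dg = "\<lambda>i j. pd k (\<lambda>y. G y $ i $ j) x"
  \<comment> \<open>the Christoffel symbols of the first kind\<close>
  define L where "L l i j = 1 / 2 * (pd i (\<lambda>y. G y $ j $ l) x + pd j (\<lambda>y. G y $ i $ l) x
    - pd l (\<lambda>y. G y $ i $ j) x)" for l i j
  have Gam: "christoffel G m i j x = (\<Sum>l\<in>UNIV. ?h m l * L l i j)" for m i j
    by (simp add: christoffel_def L_def)
  have dg: "?dg b c = L c k b + L b k c" for b c
    unfolding L_def using pd_G_sym[OF x, of k b c] pd_G_sym[OF x, of b k c] pd_G_sym[OF x, of c k b]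
    by (simp add: field_simps)
  have *: "(\<Sum>b\<in>UNIV. ?dh i b * G x $ b $ c) = - (\<Sum>b\<in>UNIV. ?h i b * ?dg b c)" for c
  proof -
    have "pd k (\<lambda>y. \<Sum>b\<in>UNIV. matrix_inv (G y) $ i $ b * G y $ b $ c) x
        = pd k (\<lambda>y. if i = c then 1 else 0) x"
      by (rule pd_cong[OF open_S x]) (rule posdef_matrix.inv_mult_entry[OF posdef])
    also have "\<dots> = 0" by (rule pd_const)
    also have "pd k (\<lambda>y. \<Sum>b\<in>UNIV. matrix_inv (G y) $ i $ b * G y $ b $ c) x
        = (\<Sum>b\<in>UNIV. ?h i b * ?dg b c + ?dh i b * G x $ b $ c)"
      using x by (simp add: pd_sum[of UNIV S] pd_mult[of S] smooth_on_mult[OF open_S] smooth_Ginv smooth_G_entry)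
    finally show ?thesis by (simp add: sum.distrib)
  qed
  have "?dh i j = (\<Sum>b\<in>UNIV. ?dh i b * (\<Sum>c\<in>UNIV. G x $ b $ c * ?h c j))"
    by (simp add: mult_inv_entry if_distrib[of "(*) _"] cong: if_cong)
  also have "\<dots> = (\<Sum>b\<in>UNIV. \<Sum>c\<in>UNIV. ?dh i b * G x $ b $ c * ?h c j)"
    by (simp add: sum_distrib_left mult.assoc)
  also have "\<dots> = (\<Sum>c\<in>UNIV. (\<Sum>b\<in>UNIV. ?dh i b * G x $ b $ c) * ?h c j)"
    by (subst sum.swap) (simp add: sum_distrib_right)
  also have "\<dots> = - (\<Sum>c\<in>UNIV. \<Sum>b\<in>UNIV. ?h i b * L c k b * ?h c j)
      - (\<Sum>c\<in>UNIV. \<Sum>b\<in>UNIV. ?h i b * L b k c * ?h c j)"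
    by (simp add: * dg sum_distrib_right distrib_left distrib_right sum.distrib sum_negf[symmetric])
  also have "(\<Sum>c\<in>UNIV. \<Sum>b\<in>UNIV. ?h i b * L c k b * ?h c j)
      = (\<Sum>b\<in>UNIV. christoffel G j k b x * ?h b i)"
    by (subst sum.swap) (simp add: Gam sum_distrib_left sum_distrib_right inv_sym[of _ j] inv_sym[of _ i] mult_ac)
  also have "(\<Sum>c\<in>UNIV. \<Sum>b\<in>UNIV. ?h i b * L b k c * ?h c j)
      = (\<Sum>c\<in>UNIV. christoffel G i k c x * ?h c j)"
    by (simp add: Gam sum_distrib_right)
  finally show ?thesis by simp
qed

lemma hessian_sym:
  assumes "x \<in> S" "smooth_on S f"
  shows "hessian G f i j x = hessian G f j i x"
  unfolding hessian_def using assms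
  by (simp add: pd_commute[OF open_S, of x f i j] christoffel_sym[of x _ i j])

text \<open>Since the inverse metric is parallel, raising an index commutes with covariant differentiation.\<close>

lemma covariant_deriv_grad:
  assumes x: "x \<in> S" and f: "smooth_on S f"
  shows "covariant_deriv G (grad G f) i j x = (\<Sum>l\<in>UNIV. matrix_inv (G x) $ j $ l * hessian G f i l x)"
proof -
  let ?h = "\<lambda>i j. matrix_inv (G x) $ i $ j" and ?C = "\<lambda>k i j. christoffel G k i j x"
  let ?p = "\<lambda>k. pd k f x"
  have "pd i (\<lambda>y. grad G f y $ j) x
      = (\<Sum>k\<in>UNIV. ?h j k * pd i (pd k f) x + pd i (\<lambda>y. matrix_inv (G y) $ j $ k) x * ?p k)"
    unfolding grad_component using x
    by (simp add: pd_sum[of UNIV S] pd_mult[of S] smooth_on_mult[OF open_S] smooth_Ginv smooth_on_pd f)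
  also have "\<dots> = (\<Sum>k\<in>UNIV. ?h j k * pd i (pd k f) x)
      - (\<Sum>k\<in>UNIV. \<Sum>l\<in>UNIV. ?C j i l * ?h l k * ?p k)
      - (\<Sum>k\<in>UNIV. \<Sum>l\<in>UNIV. ?C k i l * ?h l j * ?p k)"
    by (simp add: pd_Ginv[OF x] sum.distrib sum_subtractf left_diff_distrib sum_distrib_right sum_negf)
  also have "(\<Sum>k\<in>UNIV. \<Sum>l\<in>UNIV. ?C j i l * ?h l k * ?p k) = (\<Sum>l\<in>UNIV. ?C j i l * grad G f x $ l)"
    by (subst sum.swap) (simp add: grad_component sum_distrib_left mult.assoc)
  also have "(\<Sum>k\<in>UNIV. \<Sum>l\<in>UNIV. ?C k i l * ?h l j * ?p k)
      = (\<Sum>l\<in>UNIV. ?h j l * (\<Sum>k\<in>UNIV. ?C k i l * ?p k))"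
    by (subst sum.swap) (simp add: sum_distrib_left Ginv_sym[OF x, of _ j] mult_ac)
  finally show ?thesis
    by (simp add: covariant_deriv_def hessian_def right_diff_distrib sum_subtractf)
qed

lemma pd_grad_ip_self:
  assumes x: "x \<in> S" and f: "smooth_on S f"
  shows "pd i (grad_ip G f f) x = 2 * (\<Sum>j\<in>UNIV. hessian G f i j x * grad G f x $ j)"
proof -
  let ?h = "\<lambda>i j. matrix_inv (G x) $ i $ j" and ?C = "\<lambda>k i j. christoffel G k i j x"
  let ?p = "\<lambda>k. pd k f x" and ?X = "\<lambda>k. grad G f x $ k" and ?H = "\<lambda>i j. hessian G f i j x"
  have "pd i (grad_ip G f f) x
      = (\<Sum>k\<in>UNIV. ?X k * pd i (pd k f) x + pd i (\<lambda>y. grad G f y $ k) x * ?p k)"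
    unfolding grad_ip_def[abs_def] using x
    by (simp add: pd_sum[of UNIV S] pd_mult[of S] smooth_on_mult[OF open_S] smooth_grad smooth_on_pd f)
  also have "\<dots> = (\<Sum>k\<in>UNIV. ?X k * pd i (pd k f) x)
      + (\<Sum>k\<in>UNIV. covariant_deriv G (grad G f) i k x * ?p k)
      - (\<Sum>k\<in>UNIV. \<Sum>l\<in>UNIV. ?C k i l * ?X l * ?p k)"
    by (simp add: covariant_deriv_def sum.distrib sum_subtractf[symmetric] distrib_right sum_distrib_right)
  also have "(\<Sum>k\<in>UNIV. \<Sum>l\<in>UNIV. ?C k i l * ?X l * ?p k) = (\<Sum>l\<in>UNIV. ?X l * (\<Sum>k\<in>UNIV. ?C k i l * ?p k))"
    by (subst sum.swap) (simp add: sum_distrib_left mult_ac)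
  also have "(\<Sum>k\<in>UNIV. covariant_deriv G (grad G f) i k x * ?p k)
      = (\<Sum>k\<in>UNIV. \<Sum>l\<in>UNIV. ?h k l * ?H i l * ?p k)"
    by (simp add: covariant_deriv_grad[OF x f] sum_distrib_right)
  also have "\<dots> = (\<Sum>l\<in>UNIV. ?H i l * ?X l)"
    by (subst sum.swap) (simp add: grad_component sum_distrib_left Ginv_sym[OF x, of _ l for l] mult_ac)
  also have "(\<Sum>k\<in>UNIV. ?X k * pd i (pd k f) x) + (\<Sum>l\<in>UNIV. ?H i l * ?X l)
      - (\<Sum>l\<in>UNIV. ?X l * (\<Sum>k\<in>UNIV. ?C k i l * ?p k)) = 2 * (\<Sum>l\<in>UNIV. ?H i l * ?X l)"
    by (simp add: hessian_def left_diff_distrib right_diff_distrib sum_subtractf mult.commute)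
  finally show ?thesis .
qed

text \<open>Because the Hessian is symmetric, its contraction with \<open>X = \<nabla>f\<close> in the second index is the
  covariant derivative of \<open>X\<close> along \<open>X\<close>.\<close>

lemma grad_grad_ip_self:
  assumes x: "x \<in> S" and f: "smooth_on S f"
  shows "grad G (grad_ip G f f) x $ k
    = 2 * (\<Sum>j\<in>UNIV. grad G f x $ j * covariant_deriv G (grad G f) j k x)"
proof -
  have "grad G (grad_ip G f f) x $ k
      = (\<Sum>i\<in>UNIV. \<Sum>j\<in>UNIV. 2 * (matrix_inv (G x) $ k $ i * (hessian G f i j x * grad G f x $ j)))"
    by (simp add: grad_component[of _ "grad_ip G f f"] pd_grad_ip_self[OF x f] sum_distrib_left mult_ac)
  also have "\<dots> = (\<Sum>j\<in>UNIV. \<Sum>i\<in>UNIV. 2 * (grad G f x $ j * (matrix_inv (G x) $ k $ i * hessian G f j i x)))"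
    by (subst sum.swap) (simp add: hessian_sym[OF x f, of _ j for j] mult_ac)
  finally show ?thesis
    by (simp add: covariant_deriv_grad[OF x f] sum_distrib_left)
qed


text \<open>The left-hand side is \<open>\<nabla>\<^sub>k \<nabla>\<^sub>j X\<^sup>k - \<nabla>\<^sub>j \<nabla>\<^sub>k X\<^sup>k\<close>, with the terms that cancel between the two parts
  left out. Second derivatives of \<open>X\<close> drop out because partial derivatives commute, first derivatives
  by the symmetry of the Christoffel symbols, and the coefficient of \<open>X\<^sup>m\<close> is the traced curvature.\<close>

lemma ricci_identity:
  fixes X :: "real^'n \<Rightarrow> real^'n"
  assumes x: "x \<in> S" and X: "\<And>j. smooth_on S (\<lambda>y. X y $ j)"
  defines "N \<equiv> covariant_deriv G X"
  shows "(\<Sum>k\<in>UNIV. pd k (N j k) x) - (\<Sum>k\<in>UNIV. pd j (N k k) x)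
      + (\<Sum>k\<in>UNIV. \<Sum>l\<in>UNIV. christoffel G k k l x * N j l x)
      - (\<Sum>k\<in>UNIV. \<Sum>l\<in>UNIV. christoffel G l k j x * N l k x)
    = (\<Sum>m\<in>UNIV. (\<Sum>k\<in>UNIV. riemann G k m k j x) * X x $ m)"
proof -
  let ?C = "\<lambda>k i j. christoffel G k i j x" and ?dC = "\<lambda>r k i j. pd r (christoffel G k i j) x"
  let ?X = "\<lambda>j. X x $ j" and ?dX = "\<lambda>i j. pd i (\<lambda>y. X y $ j) x"
  have N: "N i j x = ?dX i j + (\<Sum>m\<in>UNIV. ?C j i m * ?X m)" for i j
    by (simp add: N_def covariant_deriv_def)
  have dN: "pd r (N i j) x = pd r (pd i (\<lambda>y. X y $ j)) x
      + (\<Sum>m\<in>UNIV. ?C j i m * ?dX r m + ?dC r j i m * ?X m)" for r i j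
    unfolding N_def covariant_deriv_def[abs_def] using x
    by (simp add: pd_add[of S] pd_sum[of UNIV S] pd_mult[of S] smooth_on_mult[OF open_S]
        smooth_on_sum[OF open_S] smooth_christoffel X smooth_on_pd)
  have 1: "(\<Sum>k\<in>UNIV. pd k (N j k) x) = (\<Sum>k\<in>UNIV. pd k (pd j (\<lambda>y. X y $ k)) x)
      + (\<Sum>k\<in>UNIV. \<Sum>m\<in>UNIV. ?C k j m * ?dX k m) + (\<Sum>k\<in>UNIV. \<Sum>m\<in>UNIV. ?dC k k j m * ?X m)"
    by (simp add: dN sum.distrib)
  have 2: "(\<Sum>k\<in>UNIV. pd j (N k k) x) = (\<Sum>k\<in>UNIV. pd k (pd j (\<lambda>y. X y $ k)) x)
      + (\<Sum>k\<in>UNIV. \<Sum>m\<in>UNIV. ?C k k m * ?dX j m) + (\<Sum>k\<in>UNIV. \<Sum>m\<in>UNIV. ?dC j k k m * ?X m)"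
    by (simp add: dN sum.distrib pd_commute[OF open_S x X, of j])
  have 3: "(\<Sum>k\<in>UNIV. \<Sum>l\<in>UNIV. ?C k k l * N j l x) = (\<Sum>k\<in>UNIV. \<Sum>l\<in>UNIV. ?C k k l * ?dX j l)
      + (\<Sum>k\<in>UNIV. \<Sum>l\<in>UNIV. \<Sum>m\<in>UNIV. ?C k k l * ?C l j m * ?X m)"
    by (simp add: N sum.distrib distrib_left sum_distrib_left mult.assoc)
  have "(\<Sum>k\<in>UNIV. \<Sum>l\<in>UNIV. ?C l k j * N l k x) = (\<Sum>k\<in>UNIV. \<Sum>l\<in>UNIV. ?C l k j * ?dX l k)
      + (\<Sum>k\<in>UNIV. \<Sum>l\<in>UNIV. \<Sum>m\<in>UNIV. ?C l k j * ?C k l m * ?X m)"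
    by (simp add: N sum.distrib distrib_left sum_distrib_left mult.assoc)
  moreover have "(\<Sum>k\<in>UNIV. \<Sum>l\<in>UNIV. ?C l k j * ?dX l k) = (\<Sum>k\<in>UNIV. \<Sum>m\<in>UNIV. ?C k j m * ?dX k m)"
    by (subst sum.swap) (simp add: christoffel_sym[OF x, of _ _ j])
  moreover have "(\<Sum>k\<in>UNIV. \<Sum>l\<in>UNIV. \<Sum>m\<in>UNIV. ?C l k j * ?C k l m * ?X m)
      = (\<Sum>k\<in>UNIV. \<Sum>l\<in>UNIV. \<Sum>m\<in>UNIV. ?C k j l * ?C l k m * ?X m)"
    by (subst sum.swap) (simp add: christoffel_sym[OF x, of _ _ j])
  ultimately have 4: "(\<Sum>k\<in>UNIV. \<Sum>l\<in>UNIV. ?C l k j * N l k x)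
      = (\<Sum>k\<in>UNIV. \<Sum>m\<in>UNIV. ?C k j m * ?dX k m)
        + (\<Sum>k\<in>UNIV. \<Sum>l\<in>UNIV. \<Sum>m\<in>UNIV. ?C k j l * ?C l k m * ?X m)"
    by simp
  have "(\<Sum>m\<in>UNIV. (\<Sum>k\<in>UNIV. riemann G k m k j x) * ?X m)
      = (\<Sum>m\<in>UNIV. \<Sum>k\<in>UNIV. ?dC k k j m * ?X m) - (\<Sum>m\<in>UNIV. \<Sum>k\<in>UNIV. ?dC j k k m * ?X m)
      + (\<Sum>m\<in>UNIV. \<Sum>k\<in>UNIV. \<Sum>l\<in>UNIV. ?C k k l * ?C l j m * ?X m)
      - (\<Sum>m\<in>UNIV. \<Sum>k\<in>UNIV. \<Sum>l\<in>UNIV. ?C k j l * ?C l k m * ?X m)"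
    by (simp add: riemann_def sum_distrib_right distrib_right left_diff_distrib sum.distrib sum_subtractf)
  also have "\<dots> = (\<Sum>k\<in>UNIV. \<Sum>m\<in>UNIV. ?dC k k j m * ?X m) - (\<Sum>k\<in>UNIV. \<Sum>m\<in>UNIV. ?dC j k k m * ?X m)
      + (\<Sum>k\<in>UNIV. \<Sum>l\<in>UNIV. \<Sum>m\<in>UNIV. ?C k k l * ?C l j m * ?X m)
      - (\<Sum>k\<in>UNIV. \<Sum>l\<in>UNIV. \<Sum>m\<in>UNIV. ?C k j l * ?C l k m * ?X m)"
    by (rule arg_cong2[of _ _ _ _ "(-)"], rule arg_cong2[of _ _ _ _ "(+)"],
        rule arg_cong2[of _ _ _ _ "(-)"])
      (rule sum.swap, rule sum.swap, rule sum_rotate, rule sum_rotate)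
  finally show ?thesis unfolding 1 2 3 4 by simp
qed

text \<open>Half of \<open>\<nabla>|\<nabla>f|\<^sup>2\<close> is \<open>\<nabla>\<^sub>X X\<close> for \<open>X = \<nabla>f\<close>, with components \<open>X\<^sup>j N\<^sub>j\<^sup>k\<close>. The product rule for its
  divergence gives the trace of \<open>N\<^sup>2\<close> and \<open>X\<^sup>j \<nabla>\<^sub>k \<nabla>\<^sub>j X\<^sup>k\<close>; exchanging the two covariant derivatives in
  the latter leaves \<open>X\<^sup>j \<partial>\<^sub>j (\<Delta>f)\<close> and the Ricci term.\<close>

lemma bochner:
  assumes x: "x \<in> S" and f: "smooth_on S f"
  defines "N \<equiv> covariant_deriv G (grad G f)"
  shows "laplacian G (grad_ip G f f) x = 2 * (\<Sum>i\<in>UNIV. \<Sum>j\<in>UNIV. N i j x * N j i x)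
    + 2 * grad_ip G f (laplacian G f) x + 2 * ricci G x (grad G f x) (grad G f x)"
proof -
  let ?C = "\<lambda>k i j. christoffel G k i j x"
  let ?X = "\<lambda>j. grad G f x $ j" and ?dX = "\<lambda>i j. pd i (\<lambda>y. grad G f y $ j) x"
  note sX = smooth_grad[OF f]
  have sN: "smooth_on S (N i j)" for i j
    unfolding N_def by (rule smooth_covariant_deriv[OF f])
  define Y where "Y k y = (\<Sum>j\<in>UNIV. grad G f y $ j * N j k y)" for k y
  have sY: "smooth_on S (Y k)" for k
    unfolding Y_def[abs_def] by (intro smooth_ops sX sN)
  have gradY: "grad G (grad_ip G f f) y $ k = 2 * Y k y" if "y \<in> S" for k y
    using grad_grad_ip_self[OF that f] by (simp add: Y_def N_def)
  have "pd k (\<lambda>y. grad G (grad_ip G f f) y $ k) x = pd k (\<lambda>y. 2 * Y k y) x" for k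
    by (rule pd_cong[OF open_S x gradY])
  then have lap: "laplacian G (grad_ip G f f) x
      = 2 * ((\<Sum>k\<in>UNIV. pd k (Y k) x) + (\<Sum>k\<in>UNIV. \<Sum>l\<in>UNIV. ?C k k l * Y l x))"
    using x by (simp add: laplacian_def divergence_def gradY pd_cmult[OF sY] sum.distrib
        sum_distrib_left distrib_left mult_ac)
  have dY: "(\<Sum>k\<in>UNIV. pd k (Y k) x) = (\<Sum>j\<in>UNIV. \<Sum>k\<in>UNIV. ?X j * pd k (N j k) x)
      + (\<Sum>k\<in>UNIV. \<Sum>j\<in>UNIV. ?dX k j * N j k x)"
  proof -
    have "pd k (Y k) x = (\<Sum>j\<in>UNIV. ?X j * pd k (N j k) x) + (\<Sum>j\<in>UNIV. ?dX k j * N j k x)" for k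
      unfolding Y_def[abs_def] using x
      by (simp add: pd_sum[of UNIV S] pd_mult[of S] smooth_on_mult[OF open_S] sX sN sum.distrib)
    then show ?thesis
      by (simp add: sum.distrib) (rule sum.swap)
  qed
  have dXN: "(\<Sum>k\<in>UNIV. \<Sum>j\<in>UNIV. ?dX k j * N j k x) = (\<Sum>k\<in>UNIV. \<Sum>j\<in>UNIV. N k j x * N j k x)
      - (\<Sum>m\<in>UNIV. \<Sum>k\<in>UNIV. \<Sum>j\<in>UNIV. ?X m * (?C j k m * N j k x))"
  proof -
    have "?dX k j = N k j x - (\<Sum>m\<in>UNIV. ?C j k m * ?X m)" for k j
      by (simp add: N_def covariant_deriv_def)
    then have "(\<Sum>k\<in>UNIV. \<Sum>j\<in>UNIV. ?dX k j * N j k x) = (\<Sum>k\<in>UNIV. \<Sum>j\<in>UNIV. N k j x * N j k x)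
      - (\<Sum>k\<in>UNIV. \<Sum>j\<in>UNIV. \<Sum>m\<in>UNIV. ?X m * (?C j k m * N j k x))"
      by (simp add: left_diff_distrib right_diff_distrib sum_subtractf sum_distrib_left sum_distrib_right mult_ac)
    also have "(\<Sum>k\<in>UNIV. \<Sum>j\<in>UNIV. \<Sum>m\<in>UNIV. ?X m * (?C j k m * N j k x))
      = (\<Sum>m\<in>UNIV. \<Sum>k\<in>UNIV. \<Sum>j\<in>UNIV. ?X m * (?C j k m * N j k x))"
      by (rule sum_rotate[symmetric])
    finally show ?thesis .
  qed
  have CY: "(\<Sum>k\<in>UNIV. \<Sum>l\<in>UNIV. ?C k k l * Y l x)
      = (\<Sum>m\<in>UNIV. \<Sum>k\<in>UNIV. \<Sum>l\<in>UNIV. ?X m * (?C k k l * N m l x))"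
  proof -
    have "(\<Sum>k\<in>UNIV. \<Sum>l\<in>UNIV. ?C k k l * Y l x)
        = (\<Sum>k\<in>UNIV. \<Sum>l\<in>UNIV. \<Sum>m\<in>UNIV. ?X m * (?C k k l * N m l x))"
      by (simp add: Y_def sum_distrib_left mult_ac)
    also have "\<dots> = (\<Sum>m\<in>UNIV. \<Sum>k\<in>UNIV. \<Sum>l\<in>UNIV. ?X m * (?C k k l * N m l x))"
      by (rule sum_rotate[symmetric])
    finally show ?thesis .
  qed
  have lapf: "pd j (laplacian G f) x = (\<Sum>k\<in>UNIV. pd j (N k k) x)" for j
    unfolding laplacian_covariant_deriv[abs_def] N_def[symmetric]
    using x sN by (simp add: pd_sum[of UNIV S])
  have comm: "?X j * (\<Sum>k\<in>UNIV. pd k (N j k) x) + ?X j * (\<Sum>k\<in>UNIV. \<Sum>l\<in>UNIV. ?C k k l * N j l x)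
      - ?X j * (\<Sum>k\<in>UNIV. \<Sum>l\<in>UNIV. ?C l k j * N l k x)
      = ?X j * (\<Sum>k\<in>UNIV. pd j (N k k) x) + ?X j * (\<Sum>m\<in>UNIV. (\<Sum>k\<in>UNIV. riemann G k m k j x) * ?X m)" for j
    using arg_cong[OF ricci_identity[OF x sX, of j], of "\<lambda>r. ?X j * r"]
    unfolding N_def by (simp only: right_diff_distrib distrib_left)
  have ric: "ricci G x (grad G f x) (grad G f x)
      = (\<Sum>j\<in>UNIV. ?X j * (\<Sum>m\<in>UNIV. (\<Sum>k\<in>UNIV. riemann G k m k j x) * ?X m))"
    unfolding ricci_def by (subst sum.swap) (simp add: sum_distrib_left mult_ac)
  have "(\<Sum>k\<in>UNIV. pd k (Y k) x) + (\<Sum>k\<in>UNIV. \<Sum>l\<in>UNIV. ?C k k l * Y l x)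
    = (\<Sum>k\<in>UNIV. \<Sum>j\<in>UNIV. N k j x * N j k x)
      + (\<Sum>j\<in>UNIV. ?X j * (\<Sum>k\<in>UNIV. pd k (N j k) x) + ?X j * (\<Sum>k\<in>UNIV. \<Sum>l\<in>UNIV. ?C k k l * N j l x)
      - ?X j * (\<Sum>k\<in>UNIV. \<Sum>l\<in>UNIV. ?C l k j * N l k x))"
    by (simp add: dY dXN CY sum.distrib sum_subtractf sum_distrib_left)
  also have "\<dots> = (\<Sum>k\<in>UNIV. \<Sum>j\<in>UNIV. N k j x * N j k x) + grad_ip G f (laplacian G f) x
      + ricci G x (grad G f x) (grad G f x)"
    by (simp only: comm sum.distrib ric grad_ip_def lapf add.assoc)
  finally show ?thesis unfolding lap by simp
qed

text \<open>The Laplacian is the trace of \<open>N = \<nabla>\<nabla>f\<close>, and the trace of \<open>N\<^sup>2\<close> in Bochner's formula is at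
  least the square of the trace of \<open>N\<close> divided by the dimension.\<close>

lemma bochner_inequality:
  assumes x: "x \<in> S" and f: "smooth_on S f"
    and ric: "ricci G x (grad G f x) (grad G f x) \<ge> \<kappa> * grad_ip G f f x"
  shows "laplacian G (grad_ip G f f) x \<ge> 2 / real CARD('n) * (laplacian G f x)\<^sup>2
    + 2 * grad_ip G f (laplacian G f) x + 2 * \<kappa> * grad_ip G f f x"
proof -
  have "(laplacian G f x)\<^sup>2 \<le> real CARD('n) * (\<Sum>i\<in>UNIV. \<Sum>j\<in>UNIV.
      covariant_deriv G (grad G f) i j x * covariant_deriv G (grad G f) j i x)"
    unfolding laplacian_covariant_deriv
    by (rule posdef_matrix.trace_square_le[OF posdef[OF x], where H = "\<lambda>i j. hessian G f i j x"])
      (rule hessian_sym[OF x f], rule covariant_deriv_grad[OF x f])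
  then have "(laplacian G f x)\<^sup>2 / real CARD('n) \<le> (\<Sum>i\<in>UNIV. \<Sum>j\<in>UNIV.
      covariant_deriv G (grad G f) i j x * covariant_deriv G (grad G f) j i x)"
    by (simp add: divide_le_eq mult.commute)
  then show ?thesis
    using ric unfolding bochner[OF x f] by simp
qed

subsection \<open>The Laplacian at a maximum\<close>

lemma pd_zero_at_max:
  assumes x: "x \<in> S" and f: "smooth_on S f" and max: "\<And>y. y \<in> S \<Longrightarrow> f y \<le> f x"
  shows "pd i f x = 0"
proof -
  have "(\<lambda>v. dir_deriv v f x) = (\<lambda>v. 0)"
    by (rule differential_zero_maxmin[OF x open_S smooth_on_has_derivative[OF f x]]) (use max in auto)
  then show ?thesis by (simp add: pd_def fun_eq_iff)
qed

lemma second_dir_deriv_at_max: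
  fixes f :: "real^'n \<Rightarrow> real"
  assumes x: "x \<in> S" and f: "smooth_on S f" and max: "\<And>y. y \<in> S \<Longrightarrow> f y \<le> f x"
  shows "dir_deriv v (dir_deriv v f) x \<le> 0"
proof (rule ccontr)
  assume "\<not> dir_deriv v (dir_deriv v f) x \<le> 0"
  then have pos: "dir_deriv v (dir_deriv v f) x > 0" by simp
  have dv0: "dir_deriv v f x = 0"
    using dir_deriv_sum_pd[OF smooth_on_differentiable[OF f x]] pd_zero_at_max[OF x f max] by simp
  have "((\<lambda>s. dir_deriv v f (x + s *\<^sub>R v)) has_real_derivative dir_deriv v (dir_deriv v f) (x + 0 *\<^sub>R v)) (at 0)"
    using x by (intro has_real_derivative_along_line smooth_on_differentiable[OF smooth_on_dir_deriv[OF f]]) simp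
  then obtain d where d: "d > 0" "\<And>h. 0 < h \<Longrightarrow> h < d \<Longrightarrow> dir_deriv v f (x + h *\<^sub>R v) > 0"
    using DERIV_pos_inc_right[of "\<lambda>s. dir_deriv v f (x + s *\<^sub>R v)" _ 0] pos dv0 by auto
  have "((\<lambda>s. x + s *\<^sub>R v) \<longlongrightarrow> x + 0 *\<^sub>R v) (nhds 0)"
    by (intro tendsto_intros) (simp add: filterlim_ident)
  then have "\<forall>\<^sub>F s in nhds 0. x + s *\<^sub>R v \<in> S"
    using open_S x by (auto simp: tendsto_def)
  then obtain r where r: "r > 0" "\<And>s. \<bar>s\<bar> < r \<Longrightarrow> x + s *\<^sub>R v \<in> S"
    by (auto simp: eventually_nhds_metric dist_real_def)
  define h where "h = min d r / 2"
  have h: "0 < h" "h < d" "h < r" using d(1) r(1) by (auto simp: h_def min_def)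
  have "((\<lambda>s. f (x + s *\<^sub>R v)) has_real_derivative dir_deriv v f (x + s *\<^sub>R v)) (at s)" if "0 \<le> s" "s \<le> h" for s
    using r(2)[of s] that h by (intro has_real_derivative_along_line smooth_on_differentiable[OF f]) auto
  from MVT2[OF h(1) this] obtain s where s: "0 < s" "s < h"
    "f (x + h *\<^sub>R v) - f (x + 0 *\<^sub>R v) = (h - 0) * dir_deriv v f (x + s *\<^sub>R v)" by blast
  have "f (x + h *\<^sub>R v) > f x"
    using s d(2)[of s] h by (simp add: field_simps)
  moreover have "f (x + h *\<^sub>R v) \<le> f x" using max r(2)[of h] h by simp
  ultimately show False by simp
qed

text \<open>At a critical point the Hessian is the matrix of second partial derivatives, and in an
  orthonormal frame the Laplacian is the sum of its diagonal entries, which are second derivatives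
  along lines.\<close>

lemma laplacian_at_max:
  assumes x: "x \<in> S" and f: "smooth_on S f" and max: "\<And>y. y \<in> S \<Longrightarrow> f y \<le> f x"
  shows "laplacian G f x \<le> 0"
proof -
  obtain e :: "'n \<Rightarrow> real^'n"
    where e: "\<And>i j. matrix_inv (G x) $ i $ j = (\<Sum>a\<in>UNIV. e a $ i * e a $ j)"
    by (rule posdef_matrix.inverse_frame[OF posdef[OF x]]) blast
  have second: "dir_deriv v (dir_deriv v f) x = (\<Sum>i\<in>UNIV. \<Sum>l\<in>UNIV. v $ i * v $ l * pd i (pd l f) x)" for v
  proof -
    have "dir_deriv v (dir_deriv v f) x = dir_deriv v (\<lambda>y. \<Sum>l\<in>UNIV. v $ l * pd l f y) x"
      by (rule dir_deriv_cong[OF open_S x dir_deriv_sum_pd[OF smooth_on_differentiable[OF f]]])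
    also have "\<dots> = (\<Sum>i\<in>UNIV. v $ i * pd i (\<lambda>y. \<Sum>l\<in>UNIV. v $ l * pd l f y) x)"
      by (rule dir_deriv_sum_pd, rule smooth_on_differentiable[OF _ x]) (intro smooth_ops f)
    also have "\<dots> = (\<Sum>i\<in>UNIV. \<Sum>l\<in>UNIV. v $ i * v $ l * pd i (pd l f) x)"
      using x by (simp add: pd_sum[of UNIV S] pd_cmult[of S] smooth_on_mult[OF open_S] smooth_on_const
          smooth_on_pd f sum_distrib_left mult.assoc)
    finally show ?thesis .
  qed
  have "laplacian G f x = (\<Sum>i\<in>UNIV. \<Sum>l\<in>UNIV. \<Sum>a\<in>UNIV. e a $ i * e a $ l * pd i (pd l f) x)"
    using pd_zero_at_max[OF x f max]
    by (simp add: laplacian_covariant_deriv covariant_deriv_grad[OF x f] hessian_def e sum_distrib_right)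
  also have "\<dots> = (\<Sum>a\<in>UNIV. dir_deriv (e a) (dir_deriv (e a) f) x)"
    unfolding second by (rule sum_rotate[symmetric])
  also have "\<dots> \<le> 0" by (intro sum_nonpos second_dir_deriv_at_max[OF x f max])
  finally show ?thesis .
qed

end

section \<open>The heat equation in one chart\<close>

abbreviation time_deriv :: "((real^'n::finite) \<times> real \<Rightarrow> real) \<Rightarrow> (real^'n) \<times> real \<Rightarrow> real" where
  "time_deriv \<equiv> dir_deriv (0, 1)"

lemma has_time_deriv:
  fixes f :: "(real^'n::finite) \<times> real \<Rightarrow> real"
  assumes "smooth_on (S \<times> T) f" "x \<in> S" "t \<in> T"
  shows "((\<lambda>s. f (x, s)) has_real_derivative time_deriv f (x, t)) (at t)"
  using has_real_derivative_along_line[of f "(x, 0)" t "(0, 1)"] smooth_on_differentiable[OF assms(1)] assms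
  by simp

lemma pd_slice:
  fixes f :: "(real^'n::finite) \<times> real \<Rightarrow> real"
  assumes "smooth_on (S \<times> T) f" "x \<in> S" "t \<in> T"
  shows "pd i (\<lambda>y. f (y, t)) x = dir_deriv (axis i 1, 0) f (x, t)"
proof -
  have "((\<lambda>y. (y, t)) has_derivative (\<lambda>v. (v, 0))) (at x)"
    by (auto intro!: derivative_eq_intros)
  from diff_chain_at[OF this smooth_on_has_derivative[OF assms(1)]] assms
  have "((\<lambda>y. f (y, t)) has_derivative (\<lambda>v. dir_deriv (v, 0) f (x, t))) (at x)"
    by (simp add: o_def)
  then show ?thesis unfolding pd_def by (rule dir_deriv_eqI)
qed

text \<open>Symmetry of second derivatives in space-time. Applied once to \<open>f\<close> and once more to the components
  of its gradient, this lets the time derivative pass through the Laplacian.\<close>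

lemma time_deriv_pd:
  fixes f :: "(real^'n::finite) \<times> real \<Rightarrow> real"
  assumes f: "smooth_on (S \<times> T) f" and S: "open S" "x \<in> S" and T: "open T" "t \<in> T"
  shows "((\<lambda>s. pd i (\<lambda>y. f (y, s)) x) has_real_derivative pd i (\<lambda>y. time_deriv f (y, t)) x) (at t)"
proof -
  let ?e = "(axis i 1, 0) :: (real^'n) \<times> real"
  have "((\<lambda>s. dir_deriv ?e f (x, s)) has_real_derivative time_deriv (dir_deriv ?e f) (x, t)) (at t)"
    using has_time_deriv[OF smooth_on_dir_deriv[OF f] S(2) T(2)] .
  also have "time_deriv (dir_deriv ?e f) (x, t) = dir_deriv ?e (time_deriv f) (x, t)"
    by (rule dir_deriv_commute[OF _ _ f]) (use S T in \<open>auto simp: open_Times\<close>)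
  also have "\<dots> = pd i (\<lambda>y. time_deriv f (y, t)) x"
    by (rule pd_slice[OF smooth_on_dir_deriv[OF f] S(2) T(2), symmetric])
  finally show ?thesis
    by (rule has_field_derivative_transform_within_open[OF _ T])
      (rule pd_slice[OF f S(2), symmetric])
qed

context coordinate_metric
begin

lemma smooth_grad_spacetime:
  fixes T :: "real set"
  assumes f: "smooth_on (S \<times> T) f" and T: "open T"
  shows "smooth_on (S \<times> T) (\<lambda>z. grad G (\<lambda>y. f (y, snd z)) (fst z) $ j)"
proof -
  have op: "open (S \<times> T)" using open_S T by (rule open_Times)
  have "smooth_on (S \<times> T)
      (\<lambda>z. \<Sum>k\<in>UNIV. matrix_inv (G (fst z)) $ j $ k * dir_deriv (axis k 1, 0) f z)"
    by (intro smooth_on_sum[OF op] smooth_on_mult[OF op] smooth_on_dir_deriv[OF f]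
        smooth_on_compose_fst[OF smooth_Ginv open_S T])
  then show ?thesis
    by (rule smooth_on_cong[OF op, rotated]) (auto simp: grad_component pd_slice[OF f])
qed

lemma smooth_grad_ip_spacetime:
  fixes T :: "real set"
  assumes f: "smooth_on (S \<times> T) f" and T: "open T"
  shows "smooth_on (S \<times> T) (\<lambda>z. grad_ip G (\<lambda>y. f (y, snd z)) (\<lambda>y. f (y, snd z)) (fst z))"
proof -
  have op: "open (S \<times> T)" using open_S T by (rule open_Times)
  have "smooth_on (S \<times> T)
      (\<lambda>z. \<Sum>j\<in>UNIV. grad G (\<lambda>y. f (y, snd z)) (fst z) $ j * dir_deriv (axis j 1, 0) f z)"
    by (intro smooth_on_sum[OF op] smooth_on_mult[OF op] smooth_on_dir_deriv[OF f]
        smooth_grad_spacetime[OF f T])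
  then show ?thesis
    by (rule smooth_on_cong[OF op, rotated]) (auto simp: grad_ip_def pd_slice[OF f])
qed

lemma time_deriv_grad:
  assumes f: "smooth_on (S \<times> T) f" and x: "x \<in> S" and T: "open T" "t \<in> T"
  shows "((\<lambda>s. grad G (\<lambda>y. f (y, s)) x $ j) has_real_derivative
    grad G (\<lambda>y. time_deriv f (y, t)) x $ j) (at t)"
  unfolding grad_component
  by (intro DERIV_sum DERIV_cmult time_deriv_pd[OF f open_S x T])

lemma time_deriv_grad_ip:
  assumes f: "smooth_on (S \<times> T) f" and x: "x \<in> S" and T: "open T" "t \<in> T"
  shows "((\<lambda>s. grad_ip G (\<lambda>y. f (y, s)) (\<lambda>y. f (y, s)) x) has_real_derivative
    2 * grad_ip G (\<lambda>y. f (y, t)) (\<lambda>y. time_deriv f (y, t)) x) (at t)"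
proof -
  let ?f = "\<lambda>y. f (y, t)" and ?w = "\<lambda>y. time_deriv f (y, t)"
  have "((\<lambda>s. grad_ip G (\<lambda>y. f (y, s)) (\<lambda>y. f (y, s)) x) has_real_derivative
      (\<Sum>j\<in>UNIV. grad G ?w x $ j * pd j ?f x + pd j ?w x * grad G ?f x $ j)) (at t)"
    unfolding grad_ip_def
    by (intro DERIV_sum DERIV_mult time_deriv_grad[OF f x T] time_deriv_pd[OF f open_S x T])
  also have "(\<Sum>j\<in>UNIV. grad G ?w x $ j * pd j ?f x + pd j ?w x * grad G ?f x $ j)
      = grad_ip G ?w ?f x + grad_ip G ?f ?w x"
    by (simp add: grad_ip_def sum.distrib mult.commute)
  finally show ?thesis by (simp add: grad_ip_sym[OF x, of ?w])
qed

lemma time_deriv_laplacian: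
  assumes f: "smooth_on (S \<times> T) f" and x: "x \<in> S" and T: "open T" "t \<in> T"
  shows "((\<lambda>s. laplacian G (\<lambda>y. f (y, s)) x) has_real_derivative
    laplacian G (\<lambda>y. time_deriv f (y, t)) x) (at t)"
proof -
  define V where "V i z = grad G (\<lambda>y. f (y, snd z)) (fst z) $ i" for i z
  have V: "smooth_on (S \<times> T) (V i)" for i
    unfolding V_def[abs_def] by (rule smooth_grad_spacetime[OF f T(1)])
  have "pd i (\<lambda>y. time_deriv (V i) (y, t)) x = pd i (\<lambda>y. grad G (\<lambda>y. time_deriv f (y, t)) y $ i) x" for i
  proof (rule pd_cong[OF open_S x])
    show "time_deriv (V i) (y, t) = grad G (\<lambda>y. time_deriv f (y, t)) y $ i" if "y \<in> S" for y
    proof (rule DERIV_unique)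
      show "((\<lambda>s. V i (y, s)) has_real_derivative time_deriv (V i) (y, t)) (at t)"
        by (rule has_time_deriv[OF V that T(2)])
      show "((\<lambda>s. V i (y, s)) has_real_derivative grad G (\<lambda>y. time_deriv f (y, t)) y $ i) (at t)"
        using time_deriv_grad[OF f that T, of i] by (simp only: V_def fst_conv snd_conv)
    qed
  qed
  moreover have "((\<lambda>s. pd i (\<lambda>y. V i (y, s)) x) has_real_derivative pd i (\<lambda>y. time_deriv (V i) (y, t)) x) (at t)" for i
    by (rule time_deriv_pd[OF V open_S x T])
  ultimately have "((\<lambda>s. pd i (\<lambda>y. grad G (\<lambda>y. f (y, s)) y $ i) x) has_real_derivative
      pd i (\<lambda>y. grad G (\<lambda>y. time_deriv f (y, t)) y $ i) x) (at t)" for i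
    by (simp only: V_def fst_conv snd_conv)
  then show ?thesis
    unfolding laplacian_def divergence_def
    by (intro DERIV_sum DERIV_add DERIV_cmult time_deriv_grad[OF f x T])
qed

lemma laplacian_lincomb:
  assumes x: "x \<in> S" and f: "smooth_on S f" and h: "smooth_on S h"
  shows "laplacian G (\<lambda>y. c * f y - d * h y) x = c * laplacian G f x - d * laplacian G h x"
proof -
  note sm = smooth_on_mult[OF open_S smooth_on_const]
  have gr: "grad G (\<lambda>y. c * f y - d * h y) y $ j = c * grad G f y $ j - d * grad G h y $ j"
    if "y \<in> S" for y j
    unfolding grad_component using that
    by (simp add: pd_diff[of S] pd_cmult[of S] sm f h right_diff_distrib sum_subtractf
        sum_distrib_left mult_ac)
  have "pd i (\<lambda>y. grad G (\<lambda>y. c * f y - d * h y) y $ j) x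
      = pd i (\<lambda>y. c * grad G f y $ j - d * grad G h y $ j) x" for i j
    by (rule pd_cong[OF open_S x gr])
  then have "pd i (\<lambda>y. grad G (\<lambda>y. c * f y - d * h y) y $ j) x
      = c * pd i (\<lambda>y. grad G f y $ j) x - d * pd i (\<lambda>y. grad G h y $ j) x" for i j
    using x by (simp add: pd_diff[of S] pd_cmult[of S] sm smooth_grad f h)
  then show ?thesis
    unfolding laplacian_def divergence_def using x
    by (simp add: gr sum.distrib sum_subtractf sum_distrib_left distrib_left right_diff_distrib mult_ac)
qed

text \<open>The gradient field of \<open>u\<close> is \<open>u \<nabla>f\<close> for \<open>f = ln u\<close>, and the product rule for its divergence
  gives \<open>u \<Delta>f + \<langle>\<nabla>u, \<nabla>f\<rangle>\<close>.\<close>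

lemma laplacian_ln:
  assumes x: "x \<in> S" and u: "smooth_on S u" and pos: "\<And>y. y \<in> S \<Longrightarrow> u y > 0"
  shows "laplacian G (\<lambda>y. ln (u y)) x + grad_ip G (\<lambda>y. ln (u y)) (\<lambda>y. ln (u y)) x
    = laplacian G u x / u x"
proof -
  let ?f = "\<lambda>y. ln (u y)"
  have f: "smooth_on S ?f" by (rule smooth_on_ln[OF open_S u pos])
  have pd_u: "pd j u y = u y * pd j ?f y" if "y \<in> S" for y j
  proof -
    have "pd j ?f y = pd j u y * inverse (u y)"
      unfolding pd_def
      by (rule dir_deriv_eqI[OF has_derivative_ln[OF pos[OF that] smooth_on_has_derivative[OF u that]]])
    then show ?thesis using pos[OF that] by simp
  qed
  have gr: "grad G u y $ j = u y * grad G ?f y $ j" if "y \<in> S" for y j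
    by (simp add: grad_component pd_u[OF that] sum_distrib_left mult_ac)
  have "pd i (\<lambda>y. grad G u y $ i) x = pd i (\<lambda>y. u y * grad G ?f y $ i) x" for i
    by (rule pd_cong[OF open_S x gr])
  then have "pd i (\<lambda>y. grad G u y $ i) x
      = u x * pd i (\<lambda>y. grad G ?f y $ i) x + u x * (grad G ?f x $ i * pd i ?f x)" for i
    using x by (simp add: pd_mult[of S] u smooth_grad f pd_u)
  then have "laplacian G u x = u x * (laplacian G ?f x + grad_ip G ?f ?f x)"
    unfolding laplacian_def divergence_def grad_ip_def
    by (simp add: gr[OF x] sum.distrib distrib_left sum_distrib_left mult_ac)
  then show ?thesis using pos[OF x] by simp
qed

text \<open>The computation behind the estimate. It is used for \<open>f = ln u\<close> at a fixed time and \<open>w = f\<^sub>t\<close>; then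
  the left-hand side of the conclusion is the time derivative of \<open>a Q - b w\<close> for \<open>Q = |\<nabla>f|\<^sup>2\<close> and
  coefficients with derivatives \<open>a'\<close> and \<open>b'\<close>. At a maximum of this combination the first and second
  derivative tests trade \<open>b \<nabla>w\<close> for \<open>a \<nabla>Q\<close> and \<open>b \<Delta>w\<close> for \<open>a \<Delta>Q\<close>, Bochner's formula cancels all the
  gradient terms, and what remains is a quadratic polynomial in \<open>\<Delta>f\<close>, which is bounded by completing
  the square.\<close>

lemma derivative_at_max_le:
  assumes x: "x \<in> S" and f: "smooth_on S f" and w: "smooth_on S w"
    and w_eq: "\<And>y. y \<in> S \<Longrightarrow> w y = laplacian G f y + grad_ip G f f y"
    and ric: "ricci G x (grad G f x) (grad G f x) \<ge> - K * grad_ip G f f x"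
    and max: "\<And>y. y \<in> S \<Longrightarrow> a * grad_ip G f f y - b * w y \<le> a * grad_ip G f f x - b * w x"
    and a: "a > 0" and b': "b' = 2 * K * a + a'"
  shows "a' * grad_ip G f f x + a * (2 * grad_ip G f w x)
      - (b' * w x + b * (laplacian G w x + 2 * grad_ip G f w x))
    \<le> real CARD('n) * b'\<^sup>2 / (8 * a)"
proof -
  define Q where "Q = grad_ip G f f"
  define n where "n = real CARD('n)"
  have n: "n > 0" by (simp add: n_def)
  have Q: "smooth_on S Q" unfolding Q_def by (rule smooth_grad_ip[OF f f])
  let ?h = "\<lambda>y. a * Q y - b * w y"
  have h: "smooth_on S ?h" by (intro smooth_ops Q w)
  have hmax: "?h y \<le> ?h x" if "y \<in> S" for y using max[OF that] by (simp add: Q_def)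
  have "laplacian G ?h x \<le> 0" by (rule laplacian_at_max[OF x h hmax])
  then have lap: "a * laplacian G Q x \<le> b * laplacian G w x"
    by (simp add: laplacian_lincomb[OF x Q w])
  have "a * pd j Q x = b * pd j w x" for j
    using pd_zero_at_max[OF x h hmax, of j] x
    by (simp add: pd_diff[of S] pd_cmult[of S] smooth_on_mult[OF open_S] smooth_on_const Q w)
  then have "(\<Sum>j\<in>UNIV. grad G f x $ j * (a * pd j Q x)) = (\<Sum>j\<in>UNIV. grad G f x $ j * (b * pd j w x))"
    by simp
  then have first: "a * grad_ip G f Q x = b * grad_ip G f w x"
    by (simp add: grad_ip_def sum_distrib_left mult_ac)
  have "pd j w x = pd j (laplacian G f) x + pd j Q x" for j
  proof -
    have "pd j w x = pd j (\<lambda>y. laplacian G f y + Q y) x"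
      by (rule pd_cong[OF open_S x]) (simp add: w_eq Q_def)
    then show ?thesis using pd_add[OF smooth_laplacian[OF f] Q x] by simp
  qed
  then have gw: "grad_ip G f w x = grad_ip G f (laplacian G f) x + grad_ip G f Q x"
    by (simp add: grad_ip_def distrib_left sum.distrib)
  define y where "y = laplacian G f x"
  have "2 / n * y\<^sup>2 + 2 * grad_ip G f (laplacian G f) x + 2 * (- K) * Q x \<le> laplacian G Q x"
    using bochner_inequality[OF x f ric] by (simp only: Q_def n_def y_def)
  then have boch: "a * (2 / n * y\<^sup>2 + 2 * grad_ip G f (laplacian G f) x - 2 * K * Q x) \<le> a * laplacian G Q x"
    using a by (intro mult_left_mono) auto
  \<comment> \<open>the square is completed at \<open>y = - n b' / (4a)\<close>\<close>
  have sq: "- b' * y - 2 * a / n * y\<^sup>2 \<le> n * b'\<^sup>2 / (8 * a)"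
  proof -
    have "0 \<le> 2 * a / n * (y + n * b' / (4 * a))\<^sup>2" using a n by simp
    also have "\<dots> = 2 * a / n * y\<^sup>2 + (4 * a / n * (n * b' / (4 * a))) * y
        + 2 * a / n * (n * b' / (4 * a))\<^sup>2"
      by (simp only: power2_sum distrib_left) simp
    also have "4 * a / n * (n * b' / (4 * a)) = b'" using a n by simp
    also have "2 * a / n * (n * b' / (4 * a))\<^sup>2 = n * b'\<^sup>2 / (8 * a)"
      using a n by (simp add: power2_eq_square)
    finally show ?thesis by simp
  qed
  have wx: "w x = y + Q x" using w_eq[OF x] by (simp add: y_def Q_def)
  have "a' * Q x + a * (2 * grad_ip G f w x) - (b' * w x + b * (laplacian G w x + 2 * grad_ip G f w x))
      = a' * Q x + 2 * (a * grad_ip G f w x) - b' * w x - b * laplacian G w x - 2 * (b * grad_ip G f w x)"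
    by (simp add: algebra_simps)
  also have "\<dots> \<le> a' * Q x + 2 * (a * grad_ip G f w x) - b' * w x
      - a * (2 / n * y\<^sup>2 + 2 * grad_ip G f (laplacian G f) x - 2 * K * Q x) - 2 * (a * grad_ip G f Q x)"
    using lap boch first by linarith
  also have "\<dots> = - b' * y - 2 * a / n * y\<^sup>2"
  proof -
    define z where "z = 2 / n * y\<^sup>2"
    have "2 * a / n * y\<^sup>2 = a * z" by (simp add: z_def)
    then show ?thesis
      unfolding gw wx b' z_def[symmetric] by (simp add: algebra_simps)
  qed
  finally show ?thesis using sq by (simp add: Q_def n_def)
qed

end

section \<open>Independence of the chart\<close>

context compact_riemannian_manifold
begin

lemma chart_homeomorphism:
  "c \<in> A \<Longrightarrow> homeomorphism (fst c) (chart_image c) (snd c) (chart_inv c)"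
  using charts by (auto simp: is_chart_def)

lemma open_chart: "c \<in> A \<Longrightarrow> open (fst c)" "c \<in> A \<Longrightarrow> open (chart_image c)"
  using charts by (auto simp: is_chart_def)

lemma chart_inv_chart: "c \<in> A \<Longrightarrow> p \<in> fst c \<Longrightarrow> chart_inv c (snd c p) = p"
  using chart_homeomorphism by (auto simp: homeomorphism_def)

lemma chart_chart_inv: "c \<in> A \<Longrightarrow> x \<in> chart_image c \<Longrightarrow> snd c (chart_inv c x) = x"
  using chart_homeomorphism by (auto simp: homeomorphism_def)

lemma chart_in_image: "p \<in> fst c \<Longrightarrow> snd c p \<in> chart_image c"
  by (auto simp: chart_image_def)

lemma chart_inv_in: "c \<in> A \<Longrightarrow> x \<in> chart_image c \<Longrightarrow> chart_inv c x \<in> fst c"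
  using homeomorphism_image2[OF chart_homeomorphism] by blast

lemma local_metric: "c \<in> A \<Longrightarrow> coordinate_metric (chart_image c) (g c)"
  using open_chart metric_smooth metric_sym metric_pos by unfold_locales auto

lemma open_overlap:
  assumes "c \<in> A" "d \<in> A"
  shows "open (snd c ` (fst c \<inter> fst d))"
proof -
  have "snd c ` (fst c \<inter> fst d) = chart_image c \<inter> chart_inv c -` fst d"
  proof (intro subset_antisym subsetI)
    fix x assume "x \<in> chart_image c \<inter> chart_inv c -` fst d"
    then show "x \<in> snd c ` (fst c \<inter> fst d)"
      using chart_inv_in[OF assms(1)] chart_chart_inv[OF assms(1)]
      by (intro image_eqI[of _ _ "chart_inv c x"]) auto
  qed (auto simp: chart_image_def chart_inv_chart[OF assms(1)])
  moreover have "continuous_on (chart_image c) (chart_inv c)"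
    using chart_homeomorphism[OF assms(1)] by (simp add: homeomorphism_def)
  ultimately show ?thesis
    using continuous_open_preimage[OF _ open_chart(2)[OF assms(1)] open_chart(1)[OF assms(2)]] by simp
qed

lemma grad_norm_sq_grad_ip:
  assumes "c \<in> A" "p \<in> fst c"
  shows "grad_norm_sq g c F p = grad_ip (g c) (F \<circ> chart_inv c) (F \<circ> chart_inv c) (snd c p)"
  using coordinate_metric.metric_ip_grad_grad[OF local_metric[OF assms(1)] chart_in_image[OF assms(2)]]
  by (simp add: grad_norm_sq_def)

text \<open>The differential \<open>J\<close> of a transition map is an isometry, hence injective, hence bijective. The
  gradients in two charts represent the same linear form, so \<open>J\<close> maps one to the other.\<close>

lemma grad_norm_sq_chart_independent:
  assumes c: "c \<in> A" "p \<in> fst c" and d: "d \<in> A" "p \<in> fst d"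
    and diff: "(F \<circ> chart_inv c) differentiable (at (snd c p))"
      "(F \<circ> chart_inv d) differentiable (at (snd d p))"
  shows "grad_norm_sq g c F p = grad_norm_sq g d F p"
proof -
  interpret C: coordinate_metric "chart_image c" "g c" by (rule local_metric[OF c(1)])
  interpret D: coordinate_metric "chart_image d" "g d" by (rule local_metric[OF d(1)])
  define x where "x = snd c p"
  define \<tau> where "\<tau> = transition c d"
  define J where "J = frechet_derivative \<tau> (at x)"
  let ?U = "snd c ` (fst c \<inter> fst d)"
  let ?Fc = "F \<circ> chart_inv c" and ?Fd = "F \<circ> chart_inv d"
  let ?X = "grad (g c) ?Fc x" and ?Y = "grad (g d) ?Fd (\<tau> x)"
  have xU: "x \<in> ?U" using c d by (auto simp: x_def)
  have xc: "x \<in> chart_image c" using chart_in_image[OF c(2)] by (simp add: x_def)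
  have \<tau>x: "\<tau> x = snd d p" by (simp add: \<tau>_def transition_def x_def chart_inv_chart[OF c])
  have \<tau>x_in: "\<tau> x \<in> chart_image d" using chart_in_image[OF d(2)] by (simp add: \<tau>x)
  have \<tau>': "(\<tau> has_derivative J) (at x)"
    unfolding J_def \<tau>_def
    using smooth_on_has_derivative[OF transition_smooth[OF c(1) d(1)] xU] .
  have linJ: "linear J" using \<tau>' has_derivative_linear by blast
  have isom: "metric_ip (g d) (\<tau> x) (J v) (J w) = metric_ip (g c) x v w" for v w
    using metric_compatible[OF c(1) d(1) xU] by (simp add: J_def \<tau>_def)
  have "J v = 0 \<Longrightarrow> v = 0" for v
    using isom[of v v] C.G_pos[OF xc, of v] by (auto simp: metric_ip_def)
  then have "inj J" using linear_injective_0[OF linJ] by blast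
  then have surjJ: "surj J" using linear_injective_imp_surjective[OF linJ] by blast
  have dF: "dir_deriv v ?Fc x = dir_deriv (J v) ?Fd (\<tau> x)" for v
  proof -
    have "(?Fd has_derivative frechet_derivative ?Fd (at (\<tau> x))) (at (\<tau> x))"
      using diff(2) by (simp add: \<tau>x frechet_derivative_works)
    from dir_deriv_eqI[OF diff_chain_at[OF \<tau>' this], of v]
    have "dir_deriv v (?Fd \<circ> \<tau>) x = dir_deriv (J v) ?Fd (\<tau> x)" by (simp add: o_def)
    moreover have "dir_deriv v ?Fc x = dir_deriv v (?Fd \<circ> \<tau>) x"
    proof (rule dir_deriv_cong[OF open_overlap[OF c(1) d(1)] xU])
      fix y assume "y \<in> ?U"
      then obtain q where q: "q \<in> fst c" "q \<in> fst d" "y = snd c q" by auto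
      then show "?Fc y = (?Fd \<circ> \<tau>) y"
        by (simp add: \<tau>_def transition_def chart_inv_chart c d)
    qed
    ultimately show ?thesis by simp
  qed
  have "metric_ip (g d) (\<tau> x) (J v) ?Y = metric_ip (g d) (\<tau> x) (J v) (J ?X)" for v
  proof -
    have "metric_ip (g d) (\<tau> x) (J v) ?Y = dir_deriv (J v) ?Fd (\<tau> x)"
      using D.metric_ip_grad[OF \<tau>x_in] dir_deriv_sum_pd[OF diff(2)] by (simp add: \<tau>x)
    also have "\<dots> = metric_ip (g c) x v ?X"
      using C.metric_ip_grad[OF xc] dir_deriv_sum_pd[OF diff(1)] dF[of v] by (simp add: x_def)
    finally show ?thesis by (simp add: isom)
  qed
  then have eq: "metric_ip (g d) (\<tau> x) w ?Y = metric_ip (g d) (\<tau> x) w (J ?X)" for w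
    using surjJ by (metis surjD)
  have "metric_ip (g d) (\<tau> x) (?Y - J ?X) (?Y - J ?X) = 0"
    using eq[of "?Y - J ?X"] by (simp add: metric_ip_def matrix_vector_mult_diff_distrib inner_diff_right)
  then have "?Y = J ?X" using D.G_pos[OF \<tau>x_in, of "?Y - J ?X"] by auto
  then show ?thesis
    using isom[of ?X ?X] by (simp add: grad_norm_sq_def Let_def x_def[symmetric] \<tau>x[symmetric])
qed

end

section \<open>Positive solutions of the heat equation\<close>

locale positive_heat_solution = compact_riemannian_manifold A g
  for A :: "('a::{t2_space, second_countable_topology}, 'n::finite) chart set" and g +
  fixes u :: "'a \<Rightarrow> real \<Rightarrow> real"
  assumes heat: "heat_solution A g u"
    and u_pos: "t > 0 \<Longrightarrow> u p t > 0"
begin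

definition log_u :: "('a, 'n) chart \<Rightarrow> (real^'n) \<times> real \<Rightarrow> real" where
  "log_u c z = ln (u (chart_inv c (fst z)) (snd z))"

text \<open>The squared gradient is computed in some chart around each point, so that it becomes a function on
  the manifold.\<close>

definition chart_at :: "'a \<Rightarrow> ('a, 'n) chart" where
  "chart_at p = (SOME c. c \<in> A \<and> p \<in> fst c)"

definition grad_log_sq :: "'a \<Rightarrow> real \<Rightarrow> real" where
  "grad_log_sq p t = grad_norm_sq g (chart_at p) (\<lambda>q. ln (u q t)) p"

definition log_t :: "'a \<Rightarrow> real \<Rightarrow> real" where
  "log_t p t = deriv (\<lambda>s. ln (u p s)) t"

lemma chart_at: "chart_at p \<in> A" "p \<in> fst (chart_at p)"
proof -
  have "\<exists>c. c \<in> A \<and> p \<in> fst c" using charts_cover by blast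
  then have "chart_at p \<in> A \<and> p \<in> fst (chart_at p)" unfolding chart_at_def by (rule someI_ex)
  then show "chart_at p \<in> A" "p \<in> fst (chart_at p)" by auto
qed

lemma smooth_u: "c \<in> A \<Longrightarrow> smooth_on (chart_image c \<times> {0<..}) (\<lambda>z. u (chart_inv c (fst z)) (snd z))"
  using heat by (simp add: heat_solution_def case_prod_unfold)

lemma smooth_log_u: "c \<in> A \<Longrightarrow> smooth_on (chart_image c \<times> {0<..}) (log_u c)"
  unfolding log_u_def[abs_def] using open_chart u_pos
  by (intro smooth_on_ln smooth_u open_Times) auto

lemma smooth_log_u_slice: "c \<in> A \<Longrightarrow> t > 0 \<Longrightarrow> smooth_on (chart_image c) (\<lambda>x. log_u c (x, t))"
  using smooth_on_slice[OF smooth_log_u open_chart(2)] by simp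

text \<open>Both sides are \<open>\<Delta>u / u\<close>: the left by the chain rule in time, the right by \<open>laplacian_ln\<close>.\<close>

lemma log_heat_equation:
  assumes c: "c \<in> A" and x: "x \<in> chart_image c" and t: "t > 0"
  shows "time_deriv (log_u c) (x, t) = laplacian (g c) (\<lambda>y. log_u c (y, t)) x
    + grad_ip (g c) (\<lambda>y. log_u c (y, t)) (\<lambda>y. log_u c (y, t)) x"
proof -
  interpret C: coordinate_metric "chart_image c" "g c" by (rule local_metric[OF c])
  let ?p = "chart_inv c x" and ?v = "\<lambda>y. u (chart_inv c y) t"
  have v: "smooth_on (chart_image c) ?v"
    using smooth_on_slice[OF smooth_u[OF c] open_chart(2)[OF c], of t] t by simp
  have "((\<lambda>s. u ?p s) has_real_derivative laplace_beltrami g c (\<lambda>q. u q t) ?p) (at t)"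
    using heat c chart_inv_in[OF c x] t by (auto simp: heat_solution_def)
  then have "((\<lambda>s. u ?p s) has_real_derivative laplacian (g c) ?v x) (at t)"
    by (simp add: laplace_beltrami_def chart_chart_inv[OF c x] o_def)
  from DERIV_chain2[OF DERIV_ln_divide[OF u_pos[OF t]] this]
  have 1: "((\<lambda>s. ln (u ?p s)) has_real_derivative 1 / u ?p t * laplacian (g c) ?v x) (at t)" .
  have 2: "((\<lambda>s. ln (u ?p s)) has_real_derivative time_deriv (log_u c) (x, t)) (at t)"
    using has_time_deriv[OF smooth_log_u[OF c] x, of t] t by (simp add: log_u_def)
  have "time_deriv (log_u c) (x, t) = laplacian (g c) ?v x / ?v x"
    using DERIV_unique[OF 2 1] by simp
  also have "\<dots> = laplacian (g c) (\<lambda>y. ln (?v y)) x + grad_ip (g c) (\<lambda>y. ln (?v y)) (\<lambda>y. ln (?v y)) x"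
    using C.laplacian_ln[OF x v] u_pos[OF t] by simp
  finally show ?thesis by (simp add: log_u_def)
qed

lemma grad_norm_sq_log:
  assumes "c \<in> A" "p \<in> fst c"
  shows "grad_norm_sq g c (\<lambda>q. ln (u q t)) p
    = grad_ip (g c) (\<lambda>y. log_u c (y, t)) (\<lambda>y. log_u c (y, t)) (snd c p)"
  by (simp add: grad_norm_sq_grad_ip[OF assms] log_u_def o_def)

lemma grad_norm_sq_eq_grad_log_sq:
  assumes "c \<in> A" "p \<in> fst c" "t > 0"
  shows "grad_norm_sq g c (\<lambda>q. ln (u q t)) p = grad_log_sq p t"
proof -
  have "((\<lambda>q. ln (u q t)) \<circ> chart_inv d) differentiable (at (snd d p))" if "d \<in> A" "p \<in> fst d" for d
    using smooth_on_differentiable[OF smooth_log_u_slice[OF that(1) assms(3)] chart_in_image[OF that(2)]]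
    by (simp add: log_u_def o_def)
  then show ?thesis
    unfolding grad_log_sq_def using assms chart_at by (intro grad_norm_sq_chart_independent) auto
qed

lemma grad_log_sq_local:
  assumes "c \<in> A" "p \<in> fst c" "t > 0"
  shows "grad_log_sq p t = grad_ip (g c) (\<lambda>y. log_u c (y, t)) (\<lambda>y. log_u c (y, t)) (snd c p)"
  using grad_norm_sq_eq_grad_log_sq[OF assms] grad_norm_sq_log[OF assms(1,2)] by simp

lemma log_t_local:
  assumes "c \<in> A" "p \<in> fst c" "t > 0"
  shows "log_t p t = time_deriv (log_u c) (snd c p, t)"
proof -
  have "((\<lambda>s. ln (u p s)) has_real_derivative time_deriv (log_u c) (snd c p, t)) (at t)"
    using has_time_deriv[OF smooth_log_u[OF assms(1)] chart_in_image[OF assms(2)], of t] assms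
    by (simp add: log_u_def chart_inv_chart)
  then show ?thesis unfolding log_t_def by (rule DERIV_imp_deriv)
qed

text \<open>The chart domains form an open cover, so continuity can be tested in each chart.\<close>

lemma continuous_on_spacetimeI:
  fixes h :: "'a \<times> real \<Rightarrow> real"
  assumes loc: "\<And>c. c \<in> A \<Longrightarrow> \<exists>k. continuous_on (chart_image c \<times> {0<..}) k \<and>
    (\<forall>p\<in>fst c. \<forall>t>0. h (p, t) = k (snd c p, t))"
  shows "continuous_on (UNIV \<times> {0<..}) h"
proof -
  have "continuous_on (fst c \<times> {0<..}) h" if c: "c \<in> A" for c
  proof -
    obtain k where k: "continuous_on (chart_image c \<times> {0<..}) k"
      and eq: "\<And>p t. p \<in> fst c \<Longrightarrow> t > 0 \<Longrightarrow> h (p, t) = k (snd c p, t)"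
      using loc[OF c] by blast
    have "continuous_on (fst c) (snd c)"
      using chart_homeomorphism[OF c] by (simp add: homeomorphism_def)
    then have "continuous_on (fst c \<times> {0<..}) (\<lambda>z. snd c (fst z))"
      by (rule continuous_on_compose2[where g = "snd c"]) (auto intro: continuous_on_fst continuous_on_id)
    then have "continuous_on (fst c \<times> {0<..}) (\<lambda>z. (snd c (fst z), snd z :: real))"
      by (intro continuous_on_Pair continuous_on_snd continuous_on_id)
    then have "continuous_on (fst c \<times> {0<..}) (\<lambda>z. k (snd c (fst z), snd z))"
      by (rule continuous_on_compose2[OF k]) (auto intro: chart_in_image)
    then show ?thesis
      by (rule continuous_on_eq) (auto simp: eq)
  qed
  then have "continuous_on (\<Union>c\<in>A. fst c \<times> {0<..}) h"
    by (intro continuous_on_open_UN open_Times open_chart) auto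
  moreover have "(\<Union>c\<in>A. fst c \<times> {0<..}) = (UNIV :: 'a set) \<times> {0::real<..}"
    using charts_cover by auto
  ultimately show ?thesis by simp
qed

lemma continuous_grad_log_sq: "continuous_on (UNIV \<times> {0<..}) (\<lambda>z. grad_log_sq (fst z) (snd z))"
proof (rule continuous_on_spacetimeI)
  fix c assume c: "c \<in> A"
  interpret C: coordinate_metric "chart_image c" "g c" by (rule local_metric[OF c])
  show "\<exists>k. continuous_on (chart_image c \<times> {0<..}) k \<and>
    (\<forall>p\<in>fst c. \<forall>t>0. grad_log_sq (fst (p, t)) (snd (p, t)) = k (snd c p, t))"
    using smooth_on_continuous[OF C.smooth_grad_ip_spacetime[OF smooth_log_u[OF c]]]
    by (intro exI[of _ "\<lambda>z. grad_ip (g c) (\<lambda>y. log_u c (y, snd z)) (\<lambda>y. log_u c (y, snd z)) (fst z)"])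
      (auto simp: grad_log_sq_local[OF c])
qed

lemma continuous_log_t: "continuous_on (UNIV \<times> {0<..}) (\<lambda>z. log_t (fst z) (snd z))"
proof (rule continuous_on_spacetimeI)
  fix c assume c: "c \<in> A"
  show "\<exists>k. continuous_on (chart_image c \<times> {0<..}) k \<and>
    (\<forall>p\<in>fst c. \<forall>t>0. log_t (fst (p, t)) (snd (p, t)) = k (snd c p, t))"
    using smooth_on_continuous[OF smooth_on_dir_deriv[OF smooth_log_u[OF c]]]
    by (intro exI[of _ "time_deriv (log_u c)"]) (auto simp: log_t_local[OF c])
qed

text \<open>The estimate in a chart around the maximum point, stated for the functions on the manifold.\<close>

lemma time_derivative_at_max:
  assumes ric: "ricci_ge A g (- K)" and t: "t > 0" and a: "a > 0" and b': "b' = 2 * K * a + a'"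
    and max: "\<And>p. a * grad_log_sq p t - b * log_t p t \<le> a * grad_log_sq q t - b * log_t q t"
  obtains Q' W' where "(grad_log_sq q has_real_derivative Q') (at t)"
    "(log_t q has_real_derivative W') (at t)"
    "a' * grad_log_sq q t + a * Q' - (b' * log_t q t + b * W') \<le> real CARD('n) * b'\<^sup>2 / (8 * a)"
proof -
  define c where "c = chart_at q"
  have c: "c \<in> A" "q \<in> fst c" using chart_at by (auto simp: c_def)
  interpret C: coordinate_metric "chart_image c" "g c" by (rule local_metric[OF c(1)])
  define x where "x = snd c q"
  have x: "x \<in> chart_image c" using chart_in_image[OF c(2)] by (simp add: x_def)
  note L = smooth_log_u[OF c(1)]
  have T: "open {0::real<..}" "t \<in> {0<..}" using t by auto
  let ?f = "\<lambda>y. log_u c (y, t)" and ?w = "\<lambda>y. time_deriv (log_u c) (y, t)"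
  let ?Q = "\<lambda>s. grad_ip (g c) (\<lambda>y. log_u c (y, s)) (\<lambda>y. log_u c (y, s)) x"
  let ?L = "\<lambda>s. laplacian (g c) (\<lambda>y. log_u c (y, s)) x"
  have f: "smooth_on (chart_image c) ?f" by (rule smooth_log_u_slice[OF c(1) t])
  have w: "smooth_on (chart_image c) ?w"
    by (rule smooth_on_slice[OF smooth_on_dir_deriv[OF L] open_chart(2)[OF c(1)] T(2)])
  have Q': "(?Q has_real_derivative 2 * grad_ip (g c) ?f ?w x) (at t)"
    by (rule C.time_deriv_grad_ip[OF L x T])
  have L': "(?L has_real_derivative laplacian (g c) ?w x) (at t)"
    by (rule C.time_deriv_laplacian[OF L x T])
  have 1: "(grad_log_sq q has_real_derivative 2 * grad_ip (g c) ?f ?w x) (at t)"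
    by (rule has_field_derivative_transform_within_open[OF Q' T])
      (simp add: grad_log_sq_local[OF c] x_def)
  have 2: "(log_t q has_real_derivative laplacian (g c) ?w x + 2 * grad_ip (g c) ?f ?w x) (at t)"
    by (rule has_field_derivative_transform_within_open[OF DERIV_add[OF L' Q'] T])
      (use x in \<open>simp add: log_t_local[OF c] log_heat_equation[OF c(1)] x_def\<close>)
  have loc: "a * grad_ip (g c) ?f ?f y - b * ?w y = a * grad_log_sq (chart_inv c y) t - b * log_t (chart_inv c y) t"
    if "y \<in> chart_image c" for y
    using grad_log_sq_local[OF c(1) chart_inv_in[OF c(1) that] t]
      log_t_local[OF c(1) chart_inv_in[OF c(1) that] t]
    by (simp add: chart_chart_inv[OF c(1) that])
  have "ricci (g c) x (grad (g c) ?f x) (grad (g c) ?f x) \<ge> - K * grad_ip (g c) ?f ?f x"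
    using ric c(1) x C.metric_ip_grad_grad[OF x, of ?f ?f] unfolding ricci_ge_def by metis
  then have "a' * grad_ip (g c) ?f ?f x + a * (2 * grad_ip (g c) ?f ?w x)
      - (b' * ?w x + b * (laplacian (g c) ?w x + 2 * grad_ip (g c) ?f ?w x))
    \<le> real CARD('n) * b'\<^sup>2 / (8 * a)"
  proof (intro C.derivative_at_max_le[OF x f w log_heat_equation[OF c(1) _ t] _ _ a b'])
    show "a * grad_ip (g c) ?f ?f y - b * ?w y \<le> a * grad_ip (g c) ?f ?f x - b * ?w x"
      if "y \<in> chart_image c" for y
      using max[of "chart_inv c y"] unfolding loc[OF that] loc[OF x] by (simp add: x_def chart_inv_chart[OF c])
  qed auto
  then have "a' * grad_log_sq q t + a * (2 * grad_ip (g c) ?f ?w x)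
      - (b' * log_t q t + b * (laplacian (g c) ?w x + 2 * grad_ip (g c) ?f ?w x))
    \<le> real CARD('n) * b'\<^sup>2 / (8 * a)"
    by (simp add: grad_log_sq_local[OF c t] log_t_local[OF c t] x_def)
  with 1 2 show ?thesis by (rule that)
qed

end

section \<open>The maximum principle\<close>

text \<open>Subtracting \<open>\<delta> t\<close> makes the inequality strict: at a maximum of \<open>F - \<delta> t\<close> over a time interval
  \<open>[s, t]\<close> on which \<open>F\<close> starts out small, the time derivative of \<open>F\<close> is at most \<open>0\<close>, so \<open>F - \<delta> t\<close> was
  larger just before, unless the maximum is attained at the initial time \<open>s\<close>.\<close>

lemma parabolic_max_principle:
  fixes F :: "'a::topological_space \<Rightarrow> real \<Rightarrow> real"
  assumes comp: "compact (UNIV :: 'a set)"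
    and cont: "continuous_on (UNIV \<times> {0<..}) (\<lambda>z. F (fst z) (snd z))"
    and initial: "\<And>\<eta>. \<eta> > 0 \<Longrightarrow> \<exists>s0>0. \<forall>s p. 0 < s \<longrightarrow> s < s0 \<longrightarrow> F p s \<le> \<eta>"
    and deriv: "\<And>q \<tau>. \<tau> > 0 \<Longrightarrow> (\<And>p. F p \<tau> \<le> F q \<tau>) \<Longrightarrow> \<exists>D\<le>0. (F q has_real_derivative D) (at \<tau>)"
    and t: "t > 0"
  shows "F p t \<le> 0"
proof (rule ccontr)
  assume "\<not> F p t \<le> 0"
  then have m: "F p t > 0" by simp
  \<comment> \<open>so small that \<open>F - \<delta> t\<close> is still positive at \<open>(p, t)\<close>\<close>
  define \<delta> where "\<delta> = F p t / (2 * t)"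
  have \<delta>: "\<delta> > 0" using m t by (simp add: \<delta>_def)
  obtain s0 where s0: "s0 > 0" "\<And>s p'. 0 < s \<Longrightarrow> s < s0 \<Longrightarrow> F p' s \<le> F p t / 4"
    using initial[of "F p t / 4"] m by auto
  define s where "s = min s0 t / 2"
  have s: "0 < s" "s < s0" "s < t" using s0 t by (auto simp: s_def min_def)
  let ?S = "(UNIV :: 'a set) \<times> {s..t}" and ?G = "\<lambda>z. F (fst z) (snd z) - \<delta> * snd z"
  have "continuous_on ?S ?G"
    using s by (intro continuous_intros continuous_on_subset[OF cont]) auto
  moreover have "compact ?S" using comp by (intro compact_Times) auto
  ultimately obtain z where z: "z \<in> ?S" "\<And>y. y \<in> ?S \<Longrightarrow> ?G y \<le> ?G z"
    using continuous_attains_sup[of ?S ?G] s by fastforce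
  define q \<tau> where "q = fst z" and "\<tau> = snd z"
  have \<tau>: "s \<le> \<tau>" "\<tau> \<le> t" using z(1) by (auto simp: \<tau>_def)
  have max: "F p' t' - \<delta> * t' \<le> F q \<tau> - \<delta> * \<tau>" if "s \<le> t'" "t' \<le> t" for p' t'
    using z(2)[of "(p', t')"] that by (simp add: q_def \<tau>_def)
  have "F p t / 2 \<le> F q \<tau> - \<delta> * \<tau>"
    using max[of t p] s t by (simp add: \<delta>_def)
  moreover have "F q s - \<delta> * s \<le> F p t / 4"
    using s0(2)[of s q] s \<delta> by (smt (verit) mult_pos_pos)
  ultimately have "\<tau> \<noteq> s" using m by auto
  with \<tau> have \<tau>s: "s < \<tau>" by simp
  have "F p' \<tau> \<le> F q \<tau>" for p' using max[of \<tau> p'] \<tau> by simp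
  then obtain D where D: "D \<le> 0" "(F q has_real_derivative D) (at \<tau>)"
    using deriv[of \<tau> q] \<tau>s s by auto
  have "((\<lambda>r. F q r - \<delta> * r) has_real_derivative D - \<delta>) (at \<tau>)"
    using D(2) by (auto intro!: derivative_eq_intros)
  then obtain d where d: "d > 0" "\<And>h. 0 < h \<Longrightarrow> h < d \<Longrightarrow> F q \<tau> - \<delta> * \<tau> < F q (\<tau> - h) - \<delta> * (\<tau> - h)"
    using DERIV_neg_dec_left[of "\<lambda>r. F q r - \<delta> * r" "D - \<delta>" \<tau>] D(1) \<delta> by auto
  define h where "h = min d (\<tau> - s) / 2"
  have h: "0 < h" "h < d" "h < \<tau> - s" using d(1) \<tau>s by (auto simp: h_def min_def)
  have "F q (\<tau> - h) - \<delta> * (\<tau> - h) \<le> F q \<tau> - \<delta> * \<tau>"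
    using max[of "\<tau> - h" q] h \<tau> by simp
  with d(2)[OF h(1,2)] show False by simp
qed

section \<open>The gradient estimate\<close>

lemma integral_zero_to:
  fixes h :: "real \<Rightarrow> real"
  assumes int: "\<And>L. L > 0 \<Longrightarrow> h integrable_on {0..L}" and cont: "continuous_on {0<..} h"
  shows "\<And>t. t > 0 \<Longrightarrow> ((\<lambda>s. integral {0..s} h) has_real_derivative h t) (at t)"
    and "((\<lambda>s. integral {0..s} h) \<longlongrightarrow> 0) (at_right 0)"
proof -
  show "((\<lambda>s. integral {0..s} h) has_real_derivative h t) (at t)" if t: "t > 0" for t
  proof -
    have "isCont h t" using cont t continuous_on_eq_continuous_at[of "{0<..}" h] by auto
    then have "continuous (at t within {0..2 * t} - {}) h"
      by (simp add: continuous_at_imp_continuous_at_within)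
    then have "((\<lambda>s. integral {0..s} h) has_vector_derivative h t) (at t within {0..2 * t} - {})"
      using t by (intro integral_has_vector_derivative_continuous_at int) auto
    then show ?thesis
      using t at_within_Icc_at[of 0 t "2 * t"] by (simp add: has_real_derivative_iff_has_vector_derivative)
  qed
  have "continuous_on {0..1} (\<lambda>s. integral {0..s} h)"
    by (intro indefinite_integral_continuous_1 int) auto
  then have "((\<lambda>s. integral {0..s} h) \<longlongrightarrow> integral {0..0} h) (at 0 within {0..1})"
    unfolding continuous_on_def by (rule bspec) simp
  then show "((\<lambda>s. integral {0..s} h) \<longlongrightarrow> 0) (at_right 0)"
    by (simp add: at_within_Icc_at_right)
qed

text \<open>The value of \<open>a\<close> at \<open>0\<close> is arbitrary; correcting it to the limit makes \<open>a\<close> continuous on the closed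
  interval.\<close>

lemma integrable_from_limit_zero:
  fixes a :: "real \<Rightarrow> real"
  assumes cont: "continuous_on {0<..} a" and lim: "(a \<longlongrightarrow> l) (at_right 0)" and L: "L > 0"
  shows "a integrable_on {0..L}"
proof -
  define a0 where "a0 s = (if s = 0 then l else a s)" for s
  have "(a0 \<longlongrightarrow> a0 s) (at s within {0..L})" if s: "s \<in> {0..L}" for s
  proof (cases "s = 0")
    case True
    have "(a0 \<longlongrightarrow> l) (at_right 0)"
      by (rule Lim_transform_eventually[OF lim])
        (auto simp: a0_def eventually_at_right_less eventually_at_filter)
    then show ?thesis using L by (simp add: True a0_def at_within_Icc_at_right)
  next
    case False
    with s have "s \<in> {0<..}" by simp
    then have "(a \<longlongrightarrow> a s) (at s)"
      using cont continuous_on_eq_continuous_at[of "{0<..}" a] by (simp add: isCont_def)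
    moreover have "\<forall>\<^sub>F r in at s. a r = a0 r"
      using eventually_neq_at_within[of 0 s UNIV] by (rule eventually_mono) (simp add: a0_def)
    ultimately have "(a0 \<longlongrightarrow> a s) (at s)" by (rule Lim_transform_eventually)
    from tendsto_within_subset[OF this subset_UNIV] show ?thesis
      using False by (simp add: a0_def)
  qed
  then have "continuous_on {0..L} a0" by (simp add: continuous_on_def)
  then have "a0 integrable_on {0..L}" by (rule integrable_continuous_interval)
  then show ?thesis
    by (rule integrable_spike[where S = "{0}"]) (auto simp: a0_def)
qed

context positive_heat_solution
begin

text \<open>The maximum principle for the solution translated in time by \<open>\<epsilon>\<close>. Compactness of the manifold times
  \<open>[\<epsilon>, \<epsilon> + 1]\<close> bounds the two functions of \<open>u\<close>, so the vanishing of the coefficients at \<open>0\<close> gives the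
  initial condition.\<close>

lemma log_gradient_bound_shifted:
  fixes a a' B E :: "real \<Rightarrow> real"
  assumes ric: "ricci_ge A g (- K)" and eps: "\<epsilon> > 0"
    and a_deriv: "\<And>t. t > 0 \<Longrightarrow> (a has_real_derivative a' t) (at t)"
    and a_pos: "\<And>t. t > 0 \<Longrightarrow> a t > 0"
    and B_deriv: "\<And>t. t > 0 \<Longrightarrow> (B has_real_derivative 2 * K * a t + a' t) (at t)"
    and E_deriv: "\<And>t. t > 0 \<Longrightarrow>
      (E has_real_derivative real CARD('n) * (2 * K * a t + a' t)\<^sup>2 / (8 * a t)) (at t)"
    and lims: "(a \<longlongrightarrow> 0) (at_right 0)" "(B \<longlongrightarrow> 0) (at_right 0)" "(E \<longlongrightarrow> 0) (at_right 0)"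
    and t: "t > 0"
  shows "a t * grad_log_sq p (t + \<epsilon>) - B t * log_t p (t + \<epsilon>) - E t \<le> 0"
proof -
  let ?F = "\<lambda>p t. a t * grad_log_sq p (t + \<epsilon>) - B t * log_t p (t + \<epsilon>) - E t"
  have "?F p t \<le> 0"
  proof (rule parabolic_max_principle[where F = ?F, OF compact_space _ _ _ t])
    have shift: "continuous_on (UNIV \<times> {0<..}) (\<lambda>z. h (fst z) (snd z + \<epsilon>))"
      if "continuous_on (UNIV \<times> {0<..}) (\<lambda>z. h (fst z) (snd z))" for h :: "'a \<Rightarrow> real \<Rightarrow> real"
    proof -
      have c: "continuous_on (UNIV \<times> {0<..}) (\<lambda>z :: 'a \<times> real. (fst z, snd z + \<epsilon>))"
        by (intro continuous_on_Pair continuous_on_add continuous_on_fst continuous_on_snd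
            continuous_on_id continuous_on_const)
      have sub: "(\<lambda>z :: 'a \<times> real. (fst z, snd z + \<epsilon>)) ` (UNIV \<times> {0<..}) \<subseteq> UNIV \<times> {0<..}"
        using eps by auto
      from continuous_on_compose2[OF that c sub] show ?thesis
        by (simp only: fst_conv snd_conv)
    qed
    have coeff: "continuous_on (UNIV \<times> {0<..}) (\<lambda>z :: 'a \<times> real. k (snd z))"
      if "\<And>t. t > 0 \<Longrightarrow> (k has_real_derivative k' t) (at t)" for k k' :: "real \<Rightarrow> real"
    proof -
      have "continuous_on {0<..} k"
        using that by (intro continuous_at_imp_continuous_on) (auto intro: DERIV_isCont)
      then show ?thesis
        by (rule continuous_on_compose2) (auto intro: continuous_on_snd continuous_on_id)
    qed
    show "continuous_on (UNIV \<times> {0<..}) (\<lambda>z. ?F (fst z) (snd z))"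
      by (intro continuous_on_diff continuous_on_mult shift continuous_grad_log_sq continuous_log_t
          coeff[OF a_deriv] coeff[OF B_deriv] coeff[OF E_deriv])
  next
    fix \<eta> :: real assume \<eta>: "\<eta> > 0"
    let ?S = "(UNIV :: 'a set) \<times> {\<epsilon>..\<epsilon> + 1}"
    have comp: "compact ?S" using compact_space by (intro compact_Times) auto
    have bound: "\<exists>M. \<forall>z\<in>?S. \<bar>h z\<bar> \<le> M" if "continuous_on (UNIV \<times> {0<..}) h" for h :: "'a \<times> real \<Rightarrow> real"
    proof -
      have "continuous_on ?S h"
        using eps by (intro continuous_on_subset[OF that]) auto
      then have "bounded (h ` ?S)" using comp by (intro compact_imp_bounded compact_continuous_image)
      then show ?thesis by (auto simp: bounded_iff)
    qed
    obtain M where M: "\<And>z. z \<in> ?S \<Longrightarrow> \<bar>grad_log_sq (fst z) (snd z)\<bar> \<le> M"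
      using bound[OF continuous_grad_log_sq] by blast
    obtain N where N: "\<And>z. z \<in> ?S \<Longrightarrow> \<bar>log_t (fst z) (snd z)\<bar> \<le> N"
      using bound[OF continuous_log_t] by blast
    have "((\<lambda>s. \<bar>a s\<bar> * M + \<bar>B s\<bar> * N + \<bar>E s\<bar>) \<longlongrightarrow> \<bar>0\<bar> * M + \<bar>0\<bar> * N + \<bar>0\<bar>) (at_right 0)"
      by (intro tendsto_intros lims)
    then have "\<forall>\<^sub>F s in at_right 0. \<bar>a s\<bar> * M + \<bar>B s\<bar> * N + \<bar>E s\<bar> < \<eta>"
      using \<eta> by (auto dest: order_tendstoD(2))
    then obtain s1 where s1: "s1 > 0" "\<And>s. 0 < s \<Longrightarrow> s < s1 \<Longrightarrow> \<bar>a s\<bar> * M + \<bar>B s\<bar> * N + \<bar>E s\<bar> < \<eta>"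
      by (auto simp: eventually_at_right_field)
    have "?F p s \<le> \<eta>" if s: "0 < s" "s < min s1 1" for s p
    proof -
      have "\<bar>a s * grad_log_sq p (s + \<epsilon>)\<bar> \<le> \<bar>a s\<bar> * M"
        using M[of "(p, s + \<epsilon>)"] s unfolding abs_mult by (intro mult_left_mono) auto
      moreover have "\<bar>B s * log_t p (s + \<epsilon>)\<bar> \<le> \<bar>B s\<bar> * N"
        using N[of "(p, s + \<epsilon>)"] s unfolding abs_mult by (intro mult_left_mono) auto
      ultimately show ?thesis using s1(2)[of s] s by linarith
    qed
    then show "\<exists>s0>0. \<forall>s p. 0 < s \<longrightarrow> s < s0 \<longrightarrow> ?F p s \<le> \<eta>"
      using s1(1) by (intro exI[of _ "min s1 1"]) auto
  next
    fix q \<tau> assume \<tau>: "\<tau> > 0" and max: "\<And>p. ?F p \<tau> \<le> ?F q \<tau>"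
    have \<tau>\<epsilon>: "\<tau> + \<epsilon> > 0" using \<tau> eps by simp
    have max': "a \<tau> * grad_log_sq p (\<tau> + \<epsilon>) - B \<tau> * log_t p (\<tau> + \<epsilon>)
        \<le> a \<tau> * grad_log_sq q (\<tau> + \<epsilon>) - B \<tau> * log_t q (\<tau> + \<epsilon>)" for p
      using max[of p] by simp
    obtain Q' W' where Q': "(grad_log_sq q has_real_derivative Q') (at (\<tau> + \<epsilon>))"
      and W': "(log_t q has_real_derivative W') (at (\<tau> + \<epsilon>))"
      and le: "a' \<tau> * grad_log_sq q (\<tau> + \<epsilon>) + a \<tau> * Q'
        - ((2 * K * a \<tau> + a' \<tau>) * log_t q (\<tau> + \<epsilon>) + B \<tau> * W')
        \<le> real CARD('n) * (2 * K * a \<tau> + a' \<tau>)\<^sup>2 / (8 * a \<tau>)"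
      by (rule time_derivative_at_max[OF ric \<tau>\<epsilon> a_pos[OF \<tau>] refl max'])
    have "(?F q has_real_derivative
        a' \<tau> * grad_log_sq q (\<tau> + \<epsilon>) + Q' * a \<tau>
        - ((2 * K * a \<tau> + a' \<tau>) * log_t q (\<tau> + \<epsilon>) + W' * B \<tau>)
        - real CARD('n) * (2 * K * a \<tau> + a' \<tau>)\<^sup>2 / (8 * a \<tau>)) (at \<tau>)"
      by (intro DERIV_diff DERIV_mult a_deriv[OF \<tau>] B_deriv[OF \<tau>] E_deriv[OF \<tau>]
          Q'[unfolded DERIV_shift] W'[unfolded DERIV_shift])
    then show "\<exists>D\<le>0. (?F q has_real_derivative D) (at \<tau>)"
      using le by (intro exI conjI) (auto simp: mult.commute)
  qed
  then show ?thesis .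
qed

lemma log_gradient_bound:
  fixes a a' B E :: "real \<Rightarrow> real"
  assumes "ricci_ge A g (- K)"
    and "\<And>t. t > 0 \<Longrightarrow> (a has_real_derivative a' t) (at t)"
    and "\<And>t. t > 0 \<Longrightarrow> a t > 0"
    and "\<And>t. t > 0 \<Longrightarrow> (B has_real_derivative 2 * K * a t + a' t) (at t)"
    and "\<And>t. t > 0 \<Longrightarrow>
      (E has_real_derivative real CARD('n) * (2 * K * a t + a' t)\<^sup>2 / (8 * a t)) (at t)"
    and "(a \<longlongrightarrow> 0) (at_right 0)" "(B \<longlongrightarrow> 0) (at_right 0)" "(E \<longlongrightarrow> 0) (at_right 0)"
    and t: "t > 0"
  shows "a t * grad_log_sq p t - B t * log_t p t \<le> E t"
proof -
  have shift: "((\<lambda>\<epsilon>. h p (t + \<epsilon>)) \<longlongrightarrow> h p t) (at_right 0)"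
    if h: "continuous_on (UNIV \<times> {0<..}) (\<lambda>z. h (fst z) (snd z))" for h :: "'a \<Rightarrow> real \<Rightarrow> real"
  proof -
    have "continuous_on {0<..} (\<lambda>s. (p, s))"
      by (intro continuous_on_Pair continuous_on_const continuous_on_id)
    from continuous_on_compose2[OF h this] have "continuous_on {0<..} (h p)" by auto
    then have "isCont (h p) t" using t continuous_on_eq_continuous_at[of "{0<..}" "h p"] by auto
    moreover have "((\<lambda>\<epsilon>. t + \<epsilon>) \<longlongrightarrow> t + 0) (at_right 0)"
      by (intro tendsto_intros)
    ultimately show ?thesis using isCont_tendsto_compose[of t "h p"] by simp
  qed
  have "((\<lambda>\<epsilon>. a t * grad_log_sq p (t + \<epsilon>) - B t * log_t p (t + \<epsilon>) - E t)
      \<longlongrightarrow> a t * grad_log_sq p t - B t * log_t p t - E t) (at_right 0)"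
    by (intro tendsto_diff tendsto_mult tendsto_const shift continuous_grad_log_sq continuous_log_t)
  moreover have "\<forall>\<^sub>F \<epsilon> in at_right 0. a t * grad_log_sq p (t + \<epsilon>) - B t * log_t p (t + \<epsilon>) - E t \<le> 0"
    using log_gradient_bound_shifted[OF assms(1) _ assms(2-9)] by (auto simp: eventually_at_filter)
  ultimately have "a t * grad_log_sq p t - B t * log_t p t - E t \<le> 0"
    by (rule tendsto_upperbound) simp
  then show ?thesis by simp
qed

end

theorem theorem2p10:
  fixes A :: "('a::{t2_space, second_countable_topology}, 'n::finite) chart set"
    and g :: "('a, 'n) chart \<Rightarrow> real^'n \<Rightarrow> real^'n^'n"
    and K :: real
    and u :: "'a \<Rightarrow> real \<Rightarrow> real"
    and a a' :: "real \<Rightarrow> real"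
  assumes manifold: "compact_riemannian_manifold A g"
    and K_nonneg: "K \<ge> 0"
    and ricci: "ricci_ge A g (- K)"
    and heat: "heat_solution A g u"
    and u_pos: "\<And>p t. t > 0 \<Longrightarrow> u p t > 0"
    and a_deriv: "\<And>t. t > 0 \<Longrightarrow> (a has_real_derivative a' t) (at t)"
    and a'_cont: "continuous_on {0<..} a'"
    and a_pos: "\<And>t. t > 0 \<Longrightarrow> a t > 0"
    and a_lim: "(a \<longlongrightarrow> 0) (at_right 0)"
    and a_quot_lim: "((\<lambda>t. a t / a' t) \<longlongrightarrow> 0) (at_right 0)"
    and A2_cont: "\<And>L. L > 0 \<Longrightarrow> continuous_on {0<..L} (\<lambda>s. (a' s)\<^sup>2 / a s)"
    and A2_int: "\<And>L. L > 0 \<Longrightarrow> (\<lambda>s. (a' s)\<^sup>2 / a s) integrable_on {0..L}"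
  shows "\<forall>t>0. \<forall>c\<in>A. \<forall>p\<in>fst c.
    grad_norm_sq g c (\<lambda>q. ln (u q t)) p
      - (2 * K / a t * integral {0..t} a + 1) * deriv (\<lambda>s. ln (u p s)) t
    \<le> real CARD('n) * K / 2
      + real CARD('n) * K\<^sup>2 / (2 * a t) * integral {0..t} a
      + real CARD('n) / (8 * a t) * integral {0..t} (\<lambda>s. (a' s)\<^sup>2 / a s)"
proof (intro allI impI ballI)
  fix t :: real and c p assume t: "t > 0" and c: "c \<in> A" "p \<in> fst c"
  interpret positive_heat_solution A g u
    using manifold heat u_pos by (intro positive_heat_solution.intro positive_heat_solution_axioms.intro)
  let ?n = "real CARD('n)" and ?h = "\<lambda>s. (a' s)\<^sup>2 / a s"
  define I J where "I s = integral {0..s} a" and "J s = integral {0..s} ?h" for s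
  define B where "B s = 2 * K * I s + a s" for s
  define E where "E s = ?n * K / 2 * a s + ?n * K\<^sup>2 / 2 * I s + ?n / 8 * J s" for s
  have a_cont: "continuous_on {0<..} a"
    using a_deriv by (intro continuous_at_imp_continuous_on) (auto intro: DERIV_isCont)
  have h_cont: "continuous_on {0<..} ?h"
    using a_pos by (intro continuous_intros a_cont a'_cont) (metis greaterThan_iff less_irrefl)
  note a_int = integrable_from_limit_zero[OF a_cont a_lim]
  have I': "(I has_real_derivative a s) (at s)" if "s > 0" for s
    unfolding I_def using integral_zero_to(1)[OF a_int a_cont that] .
  have J': "(J has_real_derivative ?h s) (at s)" if "s > 0" for s
    unfolding J_def using integral_zero_to(1)[OF A2_int h_cont that] .
  have I0: "(I \<longlongrightarrow> 0) (at_right 0)" and J0: "(J \<longlongrightarrow> 0) (at_right 0)"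
    unfolding I_def J_def using integral_zero_to(2)[OF a_int a_cont] integral_zero_to(2)[OF A2_int h_cont] by auto
  have B': "(B has_real_derivative 2 * K * a s + a' s) (at s)" if "s > 0" for s
    unfolding B_def by (intro DERIV_add DERIV_cmult I' a_deriv that)
  \<comment> \<open>the three terms of \<open>E'\<close> are the expansion of the square\<close>
  have E': "(E has_real_derivative ?n * (2 * K * a s + a' s)\<^sup>2 / (8 * a s)) (at s)" if "s > 0" for s
  proof -
    have "(E has_real_derivative ?n * K / 2 * a' s + ?n * K\<^sup>2 / 2 * a s + ?n / 8 * ?h s) (at s)"
      unfolding E_def by (intro DERIV_add DERIV_cmult I' J' a_deriv that)
    also have "?n * K / 2 * a' s + ?n * K\<^sup>2 / 2 * a s + ?n / 8 * ?h s
        = ?n * (2 * K * a s + a' s)\<^sup>2 / (8 * a s)"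
      using a_pos[OF that] by (simp add: field_simps power2_eq_square)
    finally show ?thesis .
  qed
  have B0: "(B \<longlongrightarrow> 0) (at_right 0)" and E0: "(E \<longlongrightarrow> 0) (at_right 0)"
  proof -
    have "(B \<longlongrightarrow> 2 * K * 0 + 0) (at_right 0)"
      unfolding B_def by (intro tendsto_intros I0 a_lim)
    then show "(B \<longlongrightarrow> 0) (at_right 0)" by simp
    have "(E \<longlongrightarrow> ?n * K / 2 * 0 + ?n * K\<^sup>2 / 2 * 0 + ?n / 8 * 0) (at_right 0)"
      unfolding E_def by (intro tendsto_intros I0 J0 a_lim)
    then show "(E \<longlongrightarrow> 0) (at_right 0)" by simp
  qed
  have main: "a t * grad_log_sq p t - B t * log_t p t \<le> E t"
    by (rule log_gradient_bound[OF ricci a_deriv a_pos B' E' a_lim B0 E0 t])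
  have at: "a t > 0" by (rule a_pos[OF t])
  have "grad_log_sq p t - (2 * K / a t * I t + 1) * log_t p t
      = (a t * grad_log_sq p t - B t * log_t p t) / a t"
    using at by (simp add: B_def field_simps)
  also have "\<dots> \<le> E t / a t"
    using main at by (intro divide_right_mono) auto
  also have "\<dots> = ?n * K / 2 + ?n * K\<^sup>2 / (2 * a t) * I t + ?n / (8 * a t) * J t"
    using at by (simp add: E_def field_simps)
  finally show "grad_norm_sq g c (\<lambda>q. ln (u q t)) p
      - (2 * K / a t * integral {0..t} a + 1) * deriv (\<lambda>s. ln (u p s)) t
    \<le> ?n * K / 2 + ?n * K\<^sup>2 / (2 * a t) * integral {0..t} a
      + ?n / (8 * a t) * integral {0..t} (\<lambda>s. (a' s)\<^sup>2 / a s)"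
    by (simp only: grad_norm_sq_eq_grad_log_sq[OF c t] log_t_def I_def J_def)
qed

end
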